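(* Let $\Gamma$ be a finite simplicial graph, let $G_\Gamma$ be the graph product of countable groups $\{G_i\}_{i\in V(\Gamma)}$, and let $K_\Gamma=\ker\big(G_\Gamma\to\prod_{i\in V(\Gamma)}G_i\big)$. Then $K_\Gamma$ is poly-free. In addition, if each vertex group $G_i$ is poly-free, then $G_\Gamma$ is poly-free.
   Context: The graph product $G_\Gamma$ of groups $\{G_i\}_{i\in V(\Gamma)}$ is the quotient of the free product of the $G_i$ by the relations $[g_i,g_j]=1$ for all $g_i\in G_i$, $g_j\in G_j$ whenever $\{i,j\}$ is an edge of $\Gamma$. The map $G_\Gamma\to\prod_iG_i$ is the canonical epimorphism which is the identity on each vertex group. A group $G$ is poly-free if there is a finite chain of subgroups $1=H_0\unlhd H_1\unlhd\cdots\unlhd H_n=G$, each normal in the next, such that every quotient $H_{k+1}/H_k$ is a free group (of possibly infinite rank). *)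

theory Defs
  imports "HOL-Algebra.Coset" "HOL-Algebra.Product_Groups" "HOL-Library.Countable_Set"
begin

inductive_set word_cong :: "'x set \<Rightarrow> ('x list \<times> 'x list) set \<Rightarrow> ('x list \<times> 'x list) set"
  for A :: "'x set" and R :: "('x list \<times> 'x list) set"
where
  step: "(l, r) \<in> R \<Longrightarrow> u @ l @ v \<in> lists A \<Longrightarrow> u @ r @ v \<in> lists A \<Longrightarrow> (u @ l @ v, u @ r @ v) \<in> word_cong A R"
| refl: "u \<in> lists A \<Longrightarrow> (u, u) \<in> word_cong A R"
| sym: "(u, v) \<in> word_cong A R \<Longrightarrow> (v, u) \<in> word_cong A R"
| trans: "(u, v) \<in> word_cong A R \<Longrightarrow> (v, w) \<in> word_cong A R \<Longrightarrow> (u, w) \<in> word_cong A R"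

definition word_class :: "'x set \<Rightarrow> ('x list \<times> 'x list) set \<Rightarrow> 'x list \<Rightarrow> 'x list set" where
  "word_class A R w = word_cong A R `` {w}"

definition presented_monoid :: "'x set \<Rightarrow> ('x list \<times> 'x list) set \<Rightarrow> 'x list set monoid" where
  "presented_monoid A R =
    \<lparr> carrier = lists A // word_cong A R,
      monoid.mult = (\<lambda>P Q. \<Union>u\<in>P. \<Union>v\<in>Q. word_class A R (u @ v)),
      one = word_class A R [] \<rparr>"

definition word_eval :: "('b, 'c) monoid_scheme \<Rightarrow> ('x \<Rightarrow> 'b) \<Rightarrow> 'x list \<Rightarrow> 'b" where
  "word_eval H f w = foldr (\<lambda>x a. f x \<otimes>\<^bsub>H\<^esub> a) w \<one>\<^bsub>H\<^esub>"

text \<open>The letter \<open>(x, True)\<close> stands for \<open>x\<close> and \<open>(x, False)\<close> for its formal inverse.\<close>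

definition free_group_on :: "'x set \<Rightarrow> ('x \<times> bool) list set monoid" where
  "free_group_on X = presented_monoid (X \<times> UNIV) {([(x, b), (x, \<not> b)], []) | x b. x \<in> X}"

text \<open>Taking the basis inside the carrier type loses no generality: a free basis of any type
  injects into the group.\<close>

definition free_group :: "('a, 'm) monoid_scheme \<Rightarrow> bool" where
  "free_group G \<longleftrightarrow> (\<exists>X :: 'a set. G \<cong> free_group_on X)"

definition poly_free :: "('a, 'm) monoid_scheme \<Rightarrow> bool" where
  "poly_free G \<longleftrightarrow> group G \<and>
    (\<exists>(n :: nat) (H :: nat \<Rightarrow> 'a set).
       H 0 = {\<one>\<^bsub>G\<^esub>} \<and> H n = carrier G \<and>
       (\<forall>k\<le>n. subgroup (H k) G) \<and>
       (\<forall>k<n. H k \<lhd> G\<lparr>carrier := H (Suc k)\<rparr> \<and>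
              free_group (G\<lparr>carrier := H (Suc k)\<rparr> Mod H k)))"

definition finite_simplicial_graph :: "'i set \<Rightarrow> 'i set set \<Rightarrow> bool" where
  "finite_simplicial_graph V E \<longleftrightarrow> finite V \<and> (\<forall>e\<in>E. e \<subseteq> V \<and> card e = 2)"

definition free_product_letters :: "'i set \<Rightarrow> ('i \<Rightarrow> ('a, 'm) monoid_scheme) \<Rightarrow> ('i \<times> 'a) set" where
  "free_product_letters V G = (SIGMA i:V. carrier (G i))"

definition free_product_rels ::
  "'i set \<Rightarrow> ('i \<Rightarrow> ('a, 'm) monoid_scheme) \<Rightarrow> (('i \<times> 'a) list \<times> ('i \<times> 'a) list) set" where
  "free_product_rels V G =
     {([(i, \<one>\<^bsub>G i\<^esub>)], []) | i. i \<in> V} \<union>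
     {([(i, g), (i, h)], [(i, g \<otimes>\<^bsub>G i\<^esub> h)]) | i g h.
        i \<in> V \<and> g \<in> carrier (G i) \<and> h \<in> carrier (G i)}"

definition free_product :: "'i set \<Rightarrow> ('i \<Rightarrow> ('a, 'm) monoid_scheme) \<Rightarrow> ('i \<times> 'a) list set monoid" where
  "free_product V G = presented_monoid (free_product_letters V G) (free_product_rels V G)"

definition free_product_incl ::
  "'i set \<Rightarrow> ('i \<Rightarrow> ('a, 'm) monoid_scheme) \<Rightarrow> 'i \<Rightarrow> 'a \<Rightarrow> ('i \<times> 'a) list set" where
  "free_product_incl V G i g = word_class (free_product_letters V G) (free_product_rels V G) [(i, g)]"

definition normal_closure :: "('a, 'm) monoid_scheme \<Rightarrow> 'a set \<Rightarrow> 'a set" where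
  "normal_closure G S = \<Inter>{N. N \<lhd> G \<and> S \<subseteq> N}"

definition commutator :: "('a, 'm) monoid_scheme \<Rightarrow> 'a \<Rightarrow> 'a \<Rightarrow> 'a" where
  "commutator G x y = x \<otimes>\<^bsub>G\<^esub> y \<otimes>\<^bsub>G\<^esub> inv\<^bsub>G\<^esub> x \<otimes>\<^bsub>G\<^esub> inv\<^bsub>G\<^esub> y"

definition graph_relators :: "'i set \<Rightarrow> 'i set set \<Rightarrow> ('i \<Rightarrow> ('a, 'm) monoid_scheme) \<Rightarrow> ('i \<times> 'a) list set set" where
  "graph_relators V E G =
    {commutator (free_product V G) (free_product_incl V G i g) (free_product_incl V G j h) | i j g h.
       {i, j} \<in> E \<and> g \<in> carrier (G i) \<and> h \<in> carrier (G j)}"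

definition graph_product ::
  "'i set \<Rightarrow> 'i set set \<Rightarrow> ('i \<Rightarrow> ('a, 'm) monoid_scheme) \<Rightarrow> ('i \<times> 'a) list set set monoid" where
  "graph_product V E G = free_product V G Mod normal_closure (free_product V G) (graph_relators V E G)"

definition graph_product_incl ::
  "'i set \<Rightarrow> 'i set set \<Rightarrow> ('i \<Rightarrow> ('a, 'm) monoid_scheme) \<Rightarrow> 'i \<Rightarrow> 'a \<Rightarrow> ('i \<times> 'a) list set set" where
  "graph_product_incl V E G i g =
     normal_closure (free_product V G) (graph_relators V E G) #>\<^bsub>free_product V G\<^esub> free_product_incl V G i g"

definition product_incl :: "'i set \<Rightarrow> ('i \<Rightarrow> ('a, 'm) monoid_scheme) \<Rightarrow> 'i \<Rightarrow> 'a \<Rightarrow> 'i \<Rightarrow> 'a" where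
  "product_incl V G i g = (\<lambda>j\<in>V. if j = i then g else \<one>\<^bsub>G j\<^esub>)"

text \<open>\<open>the_elem\<close> is legitimate here: word evaluation is constant on the classes of the free product,
  and the map it induces there is constant on the cosets forming the graph product.  That the result
  is an epimorphism restricting to the inclusion of each vertex group is
  \<open>graph_product_proj_epi\<close> below.\<close>

definition free_product_proj ::
  "'i set \<Rightarrow> ('i \<Rightarrow> ('a, 'm) monoid_scheme) \<Rightarrow> ('i \<times> 'a) list set \<Rightarrow> 'i \<Rightarrow> 'a" where
  "free_product_proj V G c =
     the_elem (word_eval (product_group V G) (\<lambda>(i, g). product_incl V G i g) ` c)"

definition graph_product_proj ::
  "'i set \<Rightarrow> ('i \<Rightarrow> ('a, 'm) monoid_scheme) \<Rightarrow> ('i \<times> 'a) list set set \<Rightarrow> 'i \<Rightarrow> 'a" where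
  "graph_product_proj V G X = the_elem (free_product_proj V G ` X)"

lemma word_cong_lists: "(u, v) \<in> word_cong A R \<Longrightarrow> u \<in> lists A \<and> v \<in> lists A"
  by (induction rule: word_cong.induct) auto

lemma equiv_word_cong: "equiv (lists A) (word_cong A R)"
proof (rule equivI)
  show "word_cong A R \<subseteq> lists A \<times> lists A"
    using word_cong_lists by fastforce
qed (auto intro!: refl_onI symI transI intro: word_cong.intros)

lemma word_cong_append_left:
  "(u, v) \<in> word_cong A R \<Longrightarrow> w \<in> lists A \<Longrightarrow> (w @ u, w @ v) \<in> word_cong A R"
proof (induction rule: word_cong.induct)
  case (step l r u v)
  then show ?case using word_cong.step[of l r R "w @ u" v A] by auto
next
  case (refl u)
  then show ?case by (intro word_cong.refl) auto
qed (blast intro: word_cong.sym word_cong.trans)+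

lemma word_cong_append_right:
  "(u, v) \<in> word_cong A R \<Longrightarrow> w \<in> lists A \<Longrightarrow> (u @ w, v @ w) \<in> word_cong A R"
proof (induction rule: word_cong.induct)
  case (step l r u v)
  then show ?case using word_cong.step[of l r R u "v @ w" A] by auto
next
  case (refl u)
  then show ?case by (intro word_cong.refl) auto
qed (blast intro: word_cong.sym word_cong.trans)+

lemma word_class_eq_iff:
  "u \<in> lists A \<Longrightarrow> v \<in> lists A \<Longrightarrow> word_class A R u = word_class A R v \<longleftrightarrow> (u, v) \<in> word_cong A R"
  unfolding word_class_def by (rule eq_equiv_class_iff[OF equiv_word_cong])

lemma carrier_presented_monoid: "carrier (presented_monoid A R) = word_class A R ` lists A"
  by (auto simp: presented_monoid_def word_class_def quotient_def)

lemma one_presented_monoid: "\<one>\<^bsub>presented_monoid A R\<^esub> = word_class A R []"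
  by (simp add: presented_monoid_def)

lemma mult_presented_monoid:
  assumes "u \<in> lists A" "v \<in> lists A"
  shows "word_class A R u \<otimes>\<^bsub>presented_monoid A R\<^esub> word_class A R v = word_class A R (u @ v)"
proof -
  have same: "word_class A R (u' @ v') = word_class A R (u @ v)"
    if "u' \<in> word_class A R u" "v' \<in> word_class A R v" for u' v'
  proof -
    have *: "(u, u') \<in> word_cong A R" "(v, v') \<in> word_cong A R"
      using that by (simp_all add: word_class_def)
    have "(u @ v, u' @ v) \<in> word_cong A R"
      using *(1) assms(2) by (rule word_cong_append_right)
    moreover have "(u' @ v, u' @ v') \<in> word_cong A R"
      using *(2) word_cong_lists[OF *(1), THEN conjunct2] by (rule word_cong_append_left)
    ultimately have c: "(u @ v, u' @ v') \<in> word_cong A R" by (rule word_cong.trans)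
    have "word_class A R (u @ v) = word_class A R (u' @ v')"
      unfolding word_class_def by (rule equiv_class_eq[OF equiv_word_cong c])
    then show ?thesis ..
  qed
  have "u \<in> word_class A R u" "v \<in> word_class A R v"
    using word_cong.refl[OF assms(1)] word_cong.refl[OF assms(2)] by (simp_all add: word_class_def)
  then have "word_class A R u \<noteq> {}" "word_class A R v \<noteq> {}" by blast+
  then have "(\<Union>u'\<in>word_class A R u. \<Union>v'\<in>word_class A R v. word_class A R (u' @ v')) =
      word_class A R (u @ v)" by (simp add: same cong: SUP_cong)
  then show ?thesis by (simp add: presented_monoid_def)
qed

lemma monoid_presented_monoid: "monoid (presented_monoid A R)"
proof -
  have mult: "word_class A R u \<otimes>\<^bsub>presented_monoid A R\<^esub> word_class A R v = word_class A R (u @ v)"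
    if "set u \<subseteq> A" "set v \<subseteq> A" for u v
    using that by (simp add: mult_presented_monoid lists_eq_set)
  show ?thesis
  proof (rule monoidI)
    show "\<one>\<^bsub>presented_monoid A R\<^esub> \<in> carrier (presented_monoid A R)"
      by (simp add: carrier_presented_monoid one_presented_monoid)
  next
    fix x y assume "x \<in> carrier (presented_monoid A R)" "y \<in> carrier (presented_monoid A R)"
    then obtain u v where "set u \<subseteq> A" "set v \<subseteq> A" "x = word_class A R u" "y = word_class A R v"
      by (auto simp: carrier_presented_monoid lists_eq_set)
    then show "x \<otimes>\<^bsub>presented_monoid A R\<^esub> y \<in> carrier (presented_monoid A R)"
      by (simp add: mult carrier_presented_monoid lists_eq_set)
  next
    fix x y z assume "x \<in> carrier (presented_monoid A R)" "y \<in> carrier (presented_monoid A R)"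
      "z \<in> carrier (presented_monoid A R)"
    then obtain u v w where "set u \<subseteq> A" "set v \<subseteq> A" "set w \<subseteq> A"
      "x = word_class A R u" "y = word_class A R v" "z = word_class A R w"
      by (auto simp: carrier_presented_monoid lists_eq_set)
    then show "x \<otimes>\<^bsub>presented_monoid A R\<^esub> y \<otimes>\<^bsub>presented_monoid A R\<^esub> z =
        x \<otimes>\<^bsub>presented_monoid A R\<^esub> (y \<otimes>\<^bsub>presented_monoid A R\<^esub> z)"
      by (simp add: mult)
  next
    fix x assume "x \<in> carrier (presented_monoid A R)"
    then obtain u where "set u \<subseteq> A" "x = word_class A R u"
      by (auto simp: carrier_presented_monoid lists_eq_set)
    then show "\<one>\<^bsub>presented_monoid A R\<^esub> \<otimes>\<^bsub>presented_monoid A R\<^esub> x = x"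
      "x \<otimes>\<^bsub>presented_monoid A R\<^esub> \<one>\<^bsub>presented_monoid A R\<^esub> = x"
      by (simp_all add: mult one_presented_monoid)
  qed
qed

lemma group_presented_monoid:
  assumes "\<And>x. x \<in> A \<Longrightarrow> \<exists>y\<in>A. ([y, x], []) \<in> word_cong A R"
  shows "group (presented_monoid A R)"
proof -
  have inv: "\<exists>v\<in>lists A. (v @ u, []) \<in> word_cong A R" if "u \<in> lists A" for u
    using that
  proof (induction u)
    case Nil
    show ?case by (rule bexI[of _ "[]"]) (simp_all add: word_cong.refl)
  next
    case (Cons x u)
    then obtain v y where *: "v \<in> lists A" "(v @ u, []) \<in> word_cong A R"
      "y \<in> A" "([y, x], []) \<in> word_cong A R" using assms[OF Cons.hyps(1)] Cons.IH by blast
    from *(4) have "([y, x] @ u, [] @ u) \<in> word_cong A R"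
      using Cons.hyps(2) by (rule word_cong_append_right)
    then have "(v @ ([y, x] @ u), v @ ([] @ u)) \<in> word_cong A R"
      using *(1) by (rule word_cong_append_left)
    then have "((v @ [y]) @ x # u, v @ u) \<in> word_cong A R" by simp
    then have "((v @ [y]) @ x # u, []) \<in> word_cong A R"
      using *(2) by (rule word_cong.trans)
    then show ?case using *(1,3) by (intro bexI[of _ "v @ [y]"]) simp_all
  qed
  show ?thesis
  proof (rule monoid.group_l_invI[OF monoid_presented_monoid])
    fix c assume "c \<in> carrier (presented_monoid A R)"
    then obtain u where u: "u \<in> lists A" "c = word_class A R u"
      by (auto simp: carrier_presented_monoid)
    from inv[OF u(1)] obtain v where v: "v \<in> lists A" "(v @ u, []) \<in> word_cong A R" by blast
    then have "word_class A R v \<otimes>\<^bsub>presented_monoid A R\<^esub> c = \<one>\<^bsub>presented_monoid A R\<^esub>"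
      using u by (simp add: mult_presented_monoid one_presented_monoid word_class_eq_iff)
    then show "\<exists>d\<in>carrier (presented_monoid A R). d \<otimes>\<^bsub>presented_monoid A R\<^esub> c = \<one>\<^bsub>presented_monoid A R\<^esub>"
      using v(1) by (auto simp: carrier_presented_monoid)
  qed
qed

lemma group_free_group_on: "group (free_group_on B)"
  unfolding free_group_on_def
proof (rule group_presented_monoid)
  let ?R = "{([(x, b), (x, \<not> b)], []) | x b. x \<in> B}"
  fix p :: "'a \<times> bool" assume "p \<in> B \<times> UNIV"
  then obtain x b where p: "p = (x, b)" "x \<in> B" by blast
  then have "([(x, \<not> b), (x, b)], []) \<in> ?R" by force
  from word_cong.step[OF this, of "[]" "[]" "B \<times> UNIV"]
  have "([(x, \<not> b), p], []) \<in> word_cong (B \<times> UNIV) ?R" using p by simp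
  moreover have "(x, \<not> b) \<in> B \<times> UNIV" using p by simp
  ultimately show "\<exists>y\<in>B \<times> UNIV. ([y, p], []) \<in> word_cong (B \<times> UNIV) ?R" by (rule bexI)
qed

lemma group_free_product:
  assumes "\<And>i. i \<in> V \<Longrightarrow> group (G i)"
  shows "group (free_product V G)"
  unfolding free_product_def
proof (rule group_presented_monoid)
  let ?A = "free_product_letters V G" and ?R = "free_product_rels V G"
  fix p assume "p \<in> ?A"
  then obtain i g where p: "p = (i, g)" "i \<in> V" "g \<in> carrier (G i)"
    by (auto simp: free_product_letters_def)
  interpret group "G i" using assms p by simp
  have "([(i, inv\<^bsub>G i\<^esub> g), (i, g)], [(i, \<one>\<^bsub>G i\<^esub>)]) \<in> ?R" "([(i, \<one>\<^bsub>G i\<^esub>)], []) \<in> ?R"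
    using p l_inv[of g] inv_closed[of g] by (force simp: free_product_rels_def)+
  from this[THEN word_cong.step, of "[]" "[]" ?A]
  have "([(i, inv\<^bsub>G i\<^esub> g), (i, g)], []) \<in> word_cong ?A ?R"
    using p by (auto simp: free_product_letters_def intro: word_cong.trans)
  then show "\<exists>y\<in>?A. ([y, p], []) \<in> word_cong ?A ?R"
    using p by (intro bexI[of _ "(i, inv\<^bsub>G i\<^esub> g)"]) (auto simp: free_product_letters_def)
qed

lemma normal_normal_closure:
  assumes "group G" "S \<subseteq> carrier G"
  shows "normal_closure G S \<lhd> G"
proof -
  interpret group G by fact
  let ?C = "{N. N \<lhd> G \<and> S \<subseteq> N}"
  have "carrier G \<in> ?C" using assms(2) by (simp add: normal_self)
  then have "subgroup (\<Inter>?C) G"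
    by (intro subgroups_Inter) (auto simp: normal_def)
  then show ?thesis
    unfolding normal_closure_def normal_inv_iff by (auto simp: normal_inv_iff)
qed

lemma free_product_incl_closed:
  "i \<in> V \<Longrightarrow> g \<in> carrier (G i) \<Longrightarrow> free_product_incl V G i g \<in> carrier (free_product V G)"
  by (auto simp: free_product_incl_def free_product_def carrier_presented_monoid
        free_product_letters_def intro!: imageI)

lemma graph_relators_closed:
  assumes "finite_simplicial_graph V E" "\<And>i. i \<in> V \<Longrightarrow> group (G i)"
  shows "graph_relators V E G \<subseteq> carrier (free_product V G)"
proof -
  interpret F: group "free_product V G" using assms(2) by (rule group_free_product)
  show ?thesis
    using assms(1) free_product_incl_closed[of _ V _ G] by (fastforce simp: graph_relators_def commutator_def finite_simplicial_graph_def)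
qed

lemma group_graph_product:
  assumes "finite_simplicial_graph V E" "\<And>i. i \<in> V \<Longrightarrow> group (G i)"
  shows "group (graph_product V E G)"
  unfolding graph_product_def
  by (intro normal.factorgroup_is_group normal_normal_closure group_free_product
      graph_relators_closed assms)

lemma word_eval_append:
  assumes "monoid H" "f ` A \<subseteq> carrier H" "u \<in> lists A" "v \<in> lists A"
  shows "word_eval H f u \<in> carrier H"
    and "word_eval H f (u @ v) = word_eval H f u \<otimes>\<^bsub>H\<^esub> word_eval H f v"
proof -
  interpret monoid H by fact
  have closed: "word_eval H f w \<in> carrier H" if "w \<in> lists A" for w
    using that assms(2) by (induction w) (auto simp: word_eval_def)
  show "word_eval H f u \<in> carrier H" by (rule closed) fact
  show "word_eval H f (u @ v) = word_eval H f u \<otimes>\<^bsub>H\<^esub> word_eval H f v"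
    using assms(3)
  proof (induction u)
    case Nil
    then show ?case using closed[OF assms(4)] by (simp add: word_eval_def)
  next
    case (Cons x u)
    then have "f x \<in> carrier H" "word_eval H f u \<in> carrier H" "word_eval H f v \<in> carrier H"
      using assms(2,4) closed by auto
    with Cons show ?case by (simp add: word_eval_def m_assoc)
  qed
qed

lemma word_eval_cong:
  assumes "monoid H" "f ` A \<subseteq> carrier H" "R \<subseteq> lists A \<times> lists A"
    and "\<And>l r. (l, r) \<in> R \<Longrightarrow> word_eval H f l = word_eval H f r"
    and "(u, v) \<in> word_cong A R"
  shows "word_eval H f u = word_eval H f v"
  using assms(5)
proof (induction rule: word_cong.induct)
  case (step l r u v)
  then have "u \<in> lists A" "v \<in> lists A" "l \<in> lists A" "r \<in> lists A" by auto
  then show ?case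
    using assms(4)[OF step(1)] by (simp add: word_eval_append[OF assms(1,2)] append_in_lists_conv)
qed auto

lemma product_incl_hom:
  assumes "\<And>i. i \<in> V \<Longrightarrow> group (G i)" "i \<in> V"
  shows "product_incl V G i \<in> hom (G i) (product_group V G)"
proof (rule homI)
  fix g assume "g \<in> carrier (G i)"
  then show "product_incl V G i g \<in> carrier (product_group V G)"
    using assms by (auto simp: product_incl_def group.is_monoid)
next
  fix g h assume "g \<in> carrier (G i)" "h \<in> carrier (G i)"
  then show "product_incl V G i (g \<otimes>\<^bsub>G i\<^esub> h) =
      product_incl V G i g \<otimes>\<^bsub>product_group V G\<^esub> product_incl V G i h"
    using assms by (auto simp: product_incl_def group.is_monoid fun_eq_iff)
qed

lemma product_incl_commute:
  assumes "\<And>i. i \<in> V \<Longrightarrow> group (G i)" "i \<in> V" "j \<in> V" "i \<noteq> j" "g \<in> carrier (G i)" "h \<in> carrier (G j)"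
  shows "product_incl V G i g \<otimes>\<^bsub>product_group V G\<^esub> product_incl V G j h =
         product_incl V G j h \<otimes>\<^bsub>product_group V G\<^esub> product_incl V G i g"
  using assms by (auto simp: product_incl_def group.is_monoid fun_eq_iff)

lemma free_product_proj_hom:
  assumes "\<And>i. i \<in> V \<Longrightarrow> group (G i)"
  shows "free_product_proj V G \<in> hom (free_product V G) (product_group V G)"
    and "i \<in> V \<Longrightarrow> g \<in> carrier (G i) \<Longrightarrow>
         free_product_proj V G (free_product_incl V G i g) = product_incl V G i g"
proof -
  let ?A = "free_product_letters V G" and ?R = "free_product_rels V G"
  let ?H = "product_group V G" and ?f = "\<lambda>(i, g). product_incl V G i g"
  interpret H: group ?H using assms by simp
  have incl: "product_incl V G i g \<in> carrier ?H" if "i \<in> V" "g \<in> carrier (G i)" for i g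
    using that product_incl_hom[where V = V and G = G and i = i] assms by (blast intro: hom_in_carrier)
  then have f: "?f ` ?A \<subseteq> carrier ?H"
    by (auto simp: free_product_letters_def simp del: carrier_product_group)
  have R: "?R \<subseteq> lists ?A \<times> lists ?A"
    using assms by (auto simp: free_product_rels_def free_product_letters_def
        group.is_monoid monoid.one_closed monoid.m_closed)
  have rel: "word_eval ?H ?f l = word_eval ?H ?f r" if "(l, r) \<in> ?R" for l r
    using that assms
    by (auto simp: free_product_rels_def word_eval_def product_incl_def group.is_monoid
        monoid.m_closed fun_eq_iff)
  have eval_class: "free_product_proj V G (word_class ?A ?R u) = word_eval ?H ?f u" if "u \<in> lists ?A" for u
  proof -
    have "word_eval ?H ?f ` word_class ?A ?R u = {word_eval ?H ?f u}"
      using word_eval_cong[OF H.is_monoid f R rel] that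
      by (auto simp: word_class_def intro!: image_eqI[of _ _ u] intro: word_cong.refl)
    then show ?thesis by (simp add: free_product_proj_def)
  qed
  show "free_product_proj V G \<in> hom (free_product V G) ?H"
  proof (rule homI)
    fix c assume "c \<in> carrier (free_product V G)"
    then obtain u where u: "u \<in> lists ?A" "c = word_class ?A ?R u"
      unfolding free_product_def carrier_presented_monoid by blast
    show "free_product_proj V G c \<in> carrier ?H"
      unfolding u(2) eval_class[OF u(1)] by (rule word_eval_append(1)[OF H.is_monoid f u(1) u(1)])
  next
    fix c d assume "c \<in> carrier (free_product V G)" "d \<in> carrier (free_product V G)"
    then obtain u v where u: "u \<in> lists ?A" "c = word_class ?A ?R u"
      and v: "v \<in> lists ?A" "d = word_class ?A ?R v"
      unfolding free_product_def carrier_presented_monoid by blast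
    have uv: "u @ v \<in> lists ?A" using u(1) v(1) by simp
    have "c \<otimes>\<^bsub>free_product V G\<^esub> d = word_class ?A ?R (u @ v)"
      unfolding u(2) v(2) free_product_def by (rule mult_presented_monoid[OF u(1) v(1)])
    then show "free_product_proj V G (c \<otimes>\<^bsub>free_product V G\<^esub> d) =
        free_product_proj V G c \<otimes>\<^bsub>?H\<^esub> free_product_proj V G d"
      by (simp only: u(2) v(2) eval_class[OF u(1)] eval_class[OF v(1)] eval_class[OF uv]
          word_eval_append(2)[OF H.is_monoid f u(1) v(1)])
  qed
  show "free_product_proj V G (free_product_incl V G i g) = product_incl V G i g"
    if "i \<in> V" "g \<in> carrier (G i)" 
  proof -
    have "[(i, g)] \<in> lists ?A" using that by (simp add: free_product_letters_def)
    moreover have "word_eval ?H ?f [(i, g)] = product_incl V G i g"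
      unfolding word_eval_def using incl[OF that]
      by (simp only: foldr.simps comp_apply id_apply prod.case H.r_one)
    ultimately show ?thesis
      by (simp only: free_product_incl_def eval_class)
  qed
qed

theorem graph_product_proj_epi:
  assumes V: "finite_simplicial_graph V E" and G: "\<And>i. i \<in> V \<Longrightarrow> group (G i)"
  shows "graph_product_proj V G \<in> epi (graph_product V E G) (product_group V G)"
    and "i \<in> V \<Longrightarrow> g \<in> carrier (G i) \<Longrightarrow>
         graph_product_proj V G (graph_product_incl V E G i g) = product_incl V G i g"
proof -
  let ?F = "free_product V G" and ?H = "product_group V G" and ?p = "free_product_proj V G"
  let ?N = "normal_closure ?F (graph_relators V E G)"
  interpret H: group ?H using G by simp
  interpret F: group ?F using G by (rule group_free_product)
  interpret p: group_hom ?F ?H ?p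
    by unfold_locales (rule free_product_proj_hom(1)[OF G])
  have N: "?N \<lhd> ?F"
    by (intro normal_normal_closure F.group_axioms graph_relators_closed V G)
  interpret N: normal ?N ?F by (rule N)
  note incl = free_product_incl_closed[of _ V _ G]
  have p_incl: "?p (free_product_incl V G i g) = product_incl V G i g"
    if "i \<in> V" "g \<in> carrier (G i)" for i g
    using G that by (rule free_product_proj_hom(2))
  have "?p r = \<one>\<^bsub>?H\<^esub>" if r_in: "r \<in> graph_relators V E G" for r
  proof -
    obtain i j g h where r: "r = commutator ?F (free_product_incl V G i g) (free_product_incl V G j h)"
      and ij: "i \<in> V" "j \<in> V" "i \<noteq> j" "g \<in> carrier (G i)" "h \<in> carrier (G j)"
    proof -
      obtain i j g h where r: "r = commutator ?F (free_product_incl V G i g) (free_product_incl V G j h)"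
        and e: "{i, j} \<in> E" and gh: "g \<in> carrier (G i)" "h \<in> carrier (G j)"
        using r_in unfolding graph_relators_def by blast
      have "{i, j} \<subseteq> V" "card {i, j} = 2" using e V by (auto simp: finite_simplicial_graph_def)
      then have "i \<in> V" "j \<in> V" "i \<noteq> j" by auto
      with r gh show ?thesis using that by blast
    qed
    let ?x = "?p (free_product_incl V G i g)" and ?y = "?p (free_product_incl V G j h)"
    have xy: "?x \<in> carrier ?H" "?y \<in> carrier ?H"
      using incl ij by (blast intro: p.hom_closed)+
    have comm: "?x \<otimes>\<^bsub>?H\<^esub> ?y = ?y \<otimes>\<^bsub>?H\<^esub> ?x"
      using product_incl_commute[OF G ij] ij by (simp only: p_incl)
    have "?p r = ?x \<otimes>\<^bsub>?H\<^esub> ?y \<otimes>\<^bsub>?H\<^esub> inv\<^bsub>?H\<^esub> ?x \<otimes>\<^bsub>?H\<^esub> inv\<^bsub>?H\<^esub> ?y"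
      using incl ij
      by (simp only: r commutator_def p.hom_mult p.hom_inv F.m_closed F.inv_closed)
    also have "\<dots> = \<one>\<^bsub>?H\<^esub>"
      using xy by (simp only: comm H.m_assoc H.r_inv H.r_one H.inv_closed H.m_closed)
    finally show ?thesis .
  qed
  then have "graph_relators V E G \<subseteq> kernel ?F ?H ?p"
    using graph_relators_closed[where G = G, OF V] G
    by (auto simp: kernel_def simp del: one_product_group)
  then have "?N \<subseteq> kernel ?F ?H ?p"
    unfolding normal_closure_def using p.normal_kernel by blast
  then have pN: "?p n = \<one>\<^bsub>?H\<^esub>" if "n \<in> ?N" for n
    using that by (auto simp: kernel_def simp del: one_product_group)
  have val: "graph_product_proj V G (?N #>\<^bsub>?F\<^esub> x) = ?p x" if x: "x \<in> carrier ?F" for x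
  proof -
    have "?p (n \<otimes>\<^bsub>?F\<^esub> x) = ?p x" if "n \<in> ?N" for n
      using pN[OF that] N.mem_carrier[OF that] x by (simp only: p.hom_mult H.l_one p.hom_closed)
    moreover have "x \<in> ?N #>\<^bsub>?F\<^esub> x" by (rule F.rcos_self[OF x N.subgroup_axioms])
    ultimately have "?p ` (?N #>\<^bsub>?F\<^esub> x) = {?p x}" unfolding r_coset_def by blast
    then show ?thesis by (simp add: graph_product_proj_def)
  qed
  have carrier: "carrier (graph_product V E G) = (\<lambda>x. ?N #>\<^bsub>?F\<^esub> x) ` carrier ?F"
    by (auto simp: graph_product_def FactGroup_def RCOSETS_def)
  have hom: "graph_product_proj V G \<in> hom (graph_product V E G) ?H"
  proof (rule homI)
    fix X assume "X \<in> carrier (graph_product V E G)"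
    then show "graph_product_proj V G X \<in> carrier ?H"
      using carrier val p.hom_closed by force
  next
    fix X Y assume "X \<in> carrier (graph_product V E G)" "Y \<in> carrier (graph_product V E G)"
    then obtain x y where xy: "x \<in> carrier ?F" "y \<in> carrier ?F"
      and X: "X = ?N #>\<^bsub>?F\<^esub> x" and Y: "Y = ?N #>\<^bsub>?F\<^esub> y"
      using carrier by auto
    have "X \<otimes>\<^bsub>graph_product V E G\<^esub> Y = ?N #>\<^bsub>?F\<^esub> (x \<otimes>\<^bsub>?F\<^esub> y)"
      using N.rcos_sum[OF xy] by (simp add: X Y graph_product_def FactGroup_def)
    then show "graph_product_proj V G (X \<otimes>\<^bsub>graph_product V E G\<^esub> Y) =
        graph_product_proj V G X \<otimes>\<^bsub>?H\<^esub> graph_product_proj V G Y"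
      by (simp only: X Y val xy F.m_closed p.hom_mult)
  qed
  have "?p ` carrier ?F = carrier ?H"
  proof
    show "carrier ?H \<subseteq> ?p ` carrier ?F"
    proof
      fix x assume x: "x \<in> carrier ?H"
      interpret im: subgroup "?p ` carrier ?F" ?H by (rule p.img_is_subgroup)
      have "(\<lambda>j\<in>V. if j \<in> S then x j else \<one>\<^bsub>G j\<^esub>) \<in> ?p ` carrier ?F" (is "?r S \<in> _")
        if "finite S" "S \<subseteq> V" for S
        using that
      proof (induction S)
        case empty
        then show ?case using im.one_closed by (simp add: restrict_def)
      next
        case (insert i S)
        then have i: "i \<in> V" "x i \<in> carrier (G i)" using x by auto
        then have "product_incl V G i (x i) \<in> ?p ` carrier ?F"
          using p_incl[OF i] incl[OF i] by (metis imageI)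
        then have "product_incl V G i (x i) \<otimes>\<^bsub>?H\<^esub> ?r S \<in> ?p ` carrier ?F"
          using insert by (intro im.m_closed) auto
        moreover have "product_incl V G i (x i) \<otimes>\<^bsub>?H\<^esub> ?r S = ?r (insert i S)"
          using insert(2) x G by (auto simp: product_incl_def fun_eq_iff group.is_monoid PiE_iff)
        ultimately show ?case by simp
      qed
      from this[of V] have "?r V \<in> ?p ` carrier ?F"
        using V unfolding finite_simplicial_graph_def by blast
      moreover have "?r V = x" using x by (auto simp: fun_eq_iff PiE_iff extensional_def)
      ultimately show "x \<in> ?p ` carrier ?F" by (simp only:)
    qed
  qed (use p.hom_closed in blast)
  then have "graph_product_proj V G ` carrier (graph_product V E G) = carrier ?H"
    unfolding carrier image_image using val by (simp cong: image_cong_simp)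
  then show "graph_product_proj V G \<in> epi (graph_product V E G) ?H"
    using hom by (simp add: epi_def)
  show "graph_product_proj V G (graph_product_incl V E G i g) = product_incl V G i g"
    if "i \<in> V" "g \<in> carrier (G i)"
    using that by (simp only: graph_product_incl_def val incl p_incl)
qed

end

theory Submission
  imports Defs "HOL-Algebra.Bij"
begin

text \<open>Poly-freeness passes to extensions (\<open>poly_free_extension\<close>), so it suffices to split off one vertex
  \<open>v\<close> at a time by homomorphisms with known kernels.  Let \<open>\<Gamma>\<close> be the graph product over \<open>V\<close> and
  \<open>\<Gamma>\<^sub>W\<close> the one over \<open>W = V - {v}\<close>.  There are a retraction \<open>\<rho>\<close> of \<open>\<Gamma>\<close> onto \<open>\<Gamma>\<^sub>W\<close> that kills
  \<open>G v\<close>, and a projection \<open>\<sigma>\<close> of \<open>\<Gamma>\<close> onto \<open>G v\<close>.  The heart of the matter is that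
  \<open>N = ker \<rho> \<inter> ker \<sigma>\<close> (\<open>free_part\<close>) is a free group.  Geometrically, with \<open>L\<close> the link of \<open>v\<close>, the group \<open>\<Gamma>\<close>
  is the amalgam of \<open>\<Gamma>\<^sub>W\<close> and \<open>\<Gamma>\<^sub>L \<times> G v\<close> over \<open>\<Gamma>\<^sub>L\<close>.  Both factors inject into
  \<open>\<Gamma>\<^sub>W \<times> G v\<close>, so \<open>N\<close> meets their conjugates trivially and acts freely on the Bass-Serre tree.

  The proof below replaces the tree by an explicit basis: the nontrivial elements among
  \<open>y(w, g) = g\<^sup>-\<^sup>1 w\<^sup>-\<^sup>1 g w\<close> (\<open>basis_elt\<close>) for \<open>w\<close> in \<open>\<Gamma>\<^sub>W\<close> and \<open>g\<close> in \<open>G v\<close>.  The identity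
  \<open>h w g = w (h g) y(w, h g) y(w, g)\<^sup>-\<^sup>1\<close> lets every element of \<open>\<Gamma>\<close> be written as \<open>w g n\<close>
  with \<open>n\<close> a product of basis elements and their inverses (\<open>normal_form\<close>), so these elements generate
  \<open>N\<close>.  Read with formal letters in place of the \<open>y(w, g)\<close>, the same identity defines an action of \<open>\<Gamma>\<close>
  on \<open>G v \<times> \<Gamma>\<^sub>W \<times> F\<close>, where \<open>F\<close> is the free group on the basis.  In it \<open>y(w, g)\<close> acts on
  \<open>{1} \<times> {1} \<times> F\<close> as left multiplication by its letter, so there are no relations among the basis elements
  (\<open>free_free_part\<close>).

  Both assertions now follow by induction on the vertex set.  The map \<open>\<rho>\<close> sends the kernel for \<open>V\<close>
  onto the kernel for \<open>W\<close>, and the kernel of that restriction is \<open>N\<close> (\<open>poly_free_K\<close>).  For \<open>\<Gamma>\<close> itself,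
  \<open>ker \<rho>\<close> is an extension of \<open>G v\<close> by \<open>N\<close>, and \<open>\<Gamma>\<close> is an extension of \<open>\<Gamma>\<^sub>W\<close> by \<open>ker \<rho>\<close>
  (\<open>poly_free_\<Gamma>\<close>).\<close>

section \<open>Presented monoids and free groups\<close>

lemma presented_monoid_lift:
  assumes H: "monoid H" "f ` A \<subseteq> carrier H" and R: "R \<subseteq> lists A \<times> lists A"
    and rel: "\<And>l r. (l, r) \<in> R \<Longrightarrow> word_eval H f l = word_eval H f r"
  obtains \<Phi> where "\<Phi> \<in> hom (presented_monoid A R) H"
    and "\<And>u. u \<in> lists A \<Longrightarrow> \<Phi> (word_class A R u) = word_eval H f u"
proof -
  define \<Phi> where "\<Phi> c = word_eval H f (SOME u. u \<in> lists A \<and> word_class A R u = c)" for c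
  have val: "\<Phi> (word_class A R u) = word_eval H f u" if "u \<in> lists A" for u
  proof -
    let ?v = "SOME v. v \<in> lists A \<and> word_class A R v = word_class A R u"
    have "?v \<in> lists A \<and> word_class A R ?v = word_class A R u"
      by (rule someI[of _ u]) (use that in simp)
    then have "(?v, u) \<in> word_cong A R"
      using word_class_eq_iff[OF _ that] by blast
    then show ?thesis
      unfolding \<Phi>_def using word_eval_cong[OF H R rel] by blast
  qed
  have "\<Phi> \<in> hom (presented_monoid A R) H"
  proof (rule homI)
    fix c assume "c \<in> carrier (presented_monoid A R)"
    then obtain u where "u \<in> lists A" "c = word_class A R u"
      unfolding carrier_presented_monoid by blast
    then show "\<Phi> c \<in> carrier H"
      using val word_eval_append(1)[OF H] by metis
  next
    fix c d assume "c \<in> carrier (presented_monoid A R)" "d \<in> carrier (presented_monoid A R)"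
    then obtain u v where uv: "u \<in> lists A" "v \<in> lists A" "c = word_class A R u" "d = word_class A R v"
      by (auto simp: carrier_presented_monoid)
    then have "u @ v \<in> lists A" by simp
    then show "\<Phi> (c \<otimes>\<^bsub>presented_monoid A R\<^esub> d) = \<Phi> c \<otimes>\<^bsub>H\<^esub> \<Phi> d"
      using uv by (simp add: val mult_presented_monoid word_eval_append(2)[OF H] del: append_in_lists_conv)
  qed
  then show ?thesis using val by (rule that)
qed

lemma presented_monoid_induct:
  assumes c: "c \<in> carrier (presented_monoid A R)"
    and one: "P \<one>\<^bsub>presented_monoid A R\<^esub>"
    and step: "\<And>x d. x \<in> A \<Longrightarrow> d \<in> carrier (presented_monoid A R) \<Longrightarrow> P d \<Longrightarrow>
       P (word_class A R [x] \<otimes>\<^bsub>presented_monoid A R\<^esub> d)"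
  shows "P c"
proof -
  obtain u where u: "u \<in> lists A" "c = word_class A R u"
    using c by (auto simp: carrier_presented_monoid)
  have "P (word_class A R u)" using u(1)
  proof (induction u)
    case Nil
    then show ?case using one by (simp add: one_presented_monoid)
  next
    case (Cons x u)
    have "word_class A R [x] \<otimes>\<^bsub>presented_monoid A R\<^esub> word_class A R u = word_class A R (x # u)"
      using Cons.hyps by (subst mult_presented_monoid) auto
    moreover have "word_class A R u \<in> carrier (presented_monoid A R)"
      using Cons.hyps by (auto simp: carrier_presented_monoid)
    ultimately show ?case using step[OF Cons.hyps(1) _ Cons.IH] by simp
  qed
  then show ?thesis using u by simp
qed

definition free_generator :: "'x set \<Rightarrow> 'x \<Rightarrow> ('x \<times> bool) list set" where
  "free_generator X x =
     word_class (X \<times> UNIV) {([(x, b), (x, \<not> b)], []) | x b. x \<in> X} [(x, True)]"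

lemma free_generator_closed: "x \<in> X \<Longrightarrow> free_generator X x \<in> carrier (free_group_on X)"
  by (auto simp: free_generator_def free_group_on_def carrier_presented_monoid intro!: imageI)

lemma inv_free_generator:
  assumes "x \<in> X"
  shows "inv\<^bsub>free_group_on X\<^esub> free_generator X x =
    word_class (X \<times> UNIV) {([(x, b), (x, \<not> b)], []) | x b. x \<in> X} [(x, False)]"
    (is "_ = word_class ?A ?R _")
proof -
  interpret group "free_group_on X" by (rule group_free_group_on)
  have l: "[(x, False)] \<in> lists ?A" "[(x, True)] \<in> lists ?A" using assms by simp_all
  then have "word_class ?A ?R [(x, False)] \<in> carrier (free_group_on X)"
    unfolding free_group_on_def carrier_presented_monoid by blast
  moreover have "word_class ?A ?R [(x, False)] \<otimes>\<^bsub>free_group_on X\<^esub> free_generator X x = \<one>\<^bsub>free_group_on X\<^esub>"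
  proof -
    have "([(x, False), (x, True)], []) \<in> ?R" using assms by force
    from word_cong.step[OF this, of "[]" "[]" ?A]
    have "([(x, False), (x, True)], []) \<in> word_cong ?A ?R" using assms by simp
    then show ?thesis
      unfolding free_generator_def free_group_on_def mult_presented_monoid[OF l] one_presented_monoid
      using l by (simp add: word_class_eq_iff)
  qed
  ultimately show ?thesis
    using free_generator_closed[OF assms] by (simp add: inv_equality)
qed

lemma free_group_on_induct:
  assumes c: "c \<in> carrier (free_group_on X)"
    and one: "P \<one>\<^bsub>free_group_on X\<^esub>"
    and gen: "\<And>x d. x \<in> X \<Longrightarrow> d \<in> carrier (free_group_on X) \<Longrightarrow> P d \<Longrightarrow>
       P (free_generator X x \<otimes>\<^bsub>free_group_on X\<^esub> d)"
    and gen_inv: "\<And>x d. x \<in> X \<Longrightarrow> d \<in> carrier (free_group_on X) \<Longrightarrow> P d \<Longrightarrow>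
       P (inv\<^bsub>free_group_on X\<^esub> free_generator X x \<otimes>\<^bsub>free_group_on X\<^esub> d)"
  shows "P c"
  using c unfolding free_group_on_def
proof (rule presented_monoid_induct, fold free_group_on_def)
  fix p :: "_ \<times> bool" and d assume "p \<in> X \<times> UNIV" and d: "d \<in> carrier (free_group_on X)" "P d"
  then obtain x b where p: "p = (x, b)" "x \<in> X" by blast
  then show "P (word_class (X \<times> UNIV) {([(x, b), (x, \<not> b)], []) |x b. x \<in> X} [p]
      \<otimes>\<^bsub>free_group_on X\<^esub> d)"
    using gen[OF p(2) d] gen_inv[OF p(2) d, unfolded inv_free_generator[OF p(2)]]
    by (cases b) (simp_all add: free_generator_def)
qed (rule one)

lemma free_group_on_lift:
  assumes "group H" "f ` X \<subseteq> carrier H"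
  obtains \<Phi> where "\<Phi> \<in> hom (free_group_on X) H"
    and "\<And>x. x \<in> X \<Longrightarrow> \<Phi> (free_generator X x) = f x"
proof -
  interpret H: group H by fact
  let ?A = "X \<times> (UNIV :: bool set)" and ?R = "{([(x, b), (x, \<not> b)], []) | x b. x \<in> X}"
  let ?f = "\<lambda>(x, b). if b then f x else inv\<^bsub>H\<^esub> f x"
  have fx: "f x \<in> carrier H" if "x \<in> X" for x using assms(2) that by blast
  have f: "?f ` ?A \<subseteq> carrier H" "?R \<subseteq> lists ?A \<times> lists ?A" using fx by auto
  have rel: "word_eval H ?f l = word_eval H ?f r" if "(l, r) \<in> ?R" for l r
    using that fx by (auto simp: word_eval_def)
  obtain \<Phi> where \<Phi>: "\<Phi> \<in> hom (presented_monoid ?A ?R) H"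
    "\<And>u. u \<in> lists ?A \<Longrightarrow> \<Phi> (word_class ?A ?R u) = word_eval H ?f u"
    by (rule presented_monoid_lift[OF H.is_monoid f]) (use rel that in blast)+
  show ?thesis
  proof (rule that)
    show "\<Phi> \<in> hom (free_group_on X) H" using \<Phi>(1) by (simp add: free_group_on_def)
    show "\<Phi> (free_generator X x) = f x" if "x \<in> X" for x
    proof -
      have "[(x, True)] \<in> lists ?A" using that by simp
      then show ?thesis
        unfolding free_generator_def using fx[OF that] by (subst \<Phi>(2)) (simp_all add: word_eval_def)
    qed
  qed
qed

text \<open>Sending one generator to 1 and all others to 0 defines a homomorphism to the integers, which separates
  that generator from the others.\<close>

lemma free_generator_inj: "inj_on (free_generator X) X"
proof (rule inj_onI, rule ccontr)
  fix x y assume xy: "x \<in> X" "y \<in> X" "free_generator X x = free_generator X y" "x \<noteq> y"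
  obtain \<Phi> where "\<And>z. z \<in> X \<Longrightarrow> \<Phi> (free_generator X z) = (if z = x then 1 else 0 :: int)"
    using free_group_on_lift[OF group_integer_group, of "\<lambda>z. if z = x then 1 else 0" X] by auto
  from this[of x] this[of y] show False using xy by simp
qed

lemma free_group_on_hom_eqI:
  assumes "group H" "\<Phi> \<in> hom (free_group_on X) H" "\<Psi> \<in> hom (free_group_on X) H"
    and eq: "\<And>x. x \<in> X \<Longrightarrow> \<Phi> (free_generator X x) = \<Psi> (free_generator X x)"
    and c: "c \<in> carrier (free_group_on X)"
  shows "\<Phi> c = \<Psi> c"
proof -
  interpret F: group "free_group_on X" by (rule group_free_group_on)
  interpret \<Phi>: group_hom "free_group_on X" H \<Phi>
    using assms by (simp add: group_hom_def group_hom_axioms_def F.group_axioms)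
  interpret \<Psi>: group_hom "free_group_on X" H \<Psi>
    using assms by (simp add: group_hom_def group_hom_axioms_def F.group_axioms)
  show ?thesis using c
    by (rule free_group_on_induct) (simp_all add: eq free_generator_closed)
qed

lemma free_group_on_relabel:
  assumes "inj_on f X"
  shows "free_group_on X \<cong> free_group_on (f ` X)"
proof -
  let ?F = "free_group_on X" and ?F' = "free_group_on (f ` X)"
  have *: "(\<lambda>x. free_generator (f ` X) (f x)) ` X \<subseteq> carrier ?F'"
    "(\<lambda>y. free_generator X (the_inv_into X f y)) ` (f ` X) \<subseteq> carrier ?F"
    by (auto simp: the_inv_into_f_f[OF assms] intro: free_generator_closed)
  obtain \<Phi> where \<Phi>: "\<Phi> \<in> hom ?F ?F'"
    "\<And>x. x \<in> X \<Longrightarrow> \<Phi> (free_generator X x) = free_generator (f ` X) (f x)"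
    using free_group_on_lift[OF group_free_group_on *(1)] by blast
  obtain \<Psi> where \<Psi>: "\<Psi> \<in> hom ?F' ?F"
    "\<And>y. y \<in> f ` X \<Longrightarrow> \<Psi> (free_generator (f ` X) y) = free_generator X (the_inv_into X f y)"
    using free_group_on_lift[OF group_free_group_on *(2)] by blast
  have 1: "(\<Psi> \<circ> \<Phi>) c = id c" if "c \<in> carrier ?F" for c
    by (rule free_group_on_hom_eqI[OF group_free_group_on hom_compose[OF \<Phi>(1) \<Psi>(1)] _ _ that])
      (auto simp: \<Phi>(2) \<Psi>(2) the_inv_into_f_f[OF assms] hom_def)
  have 2: "(\<Phi> \<circ> \<Psi>) c = id c" if "c \<in> carrier ?F'" for c
    by (rule free_group_on_hom_eqI[OF group_free_group_on hom_compose[OF \<Psi>(1) \<Phi>(1)] _ _ that])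
      (auto simp: \<Phi>(2) \<Psi>(2) the_inv_into_f_f[OF assms] hom_def)
  have "group_isomorphisms ?F ?F' \<Phi> \<Psi>"
    using 1 2 \<Phi>(1) \<Psi>(1) by (simp add: group_isomorphisms_def)
  then show ?thesis by (rule is_isoI[OF group_isomorphisms_imp_iso])
qed

text \<open>The definition of a free group asks for a basis inside the carrier type of the group, and an isomorphism
  may change that type.  The images of the generators provide a basis of the right type, since distinct
  generators of a free group are distinct elements.\<close>

lemma free_group_iso:
  fixes G :: "('a, 'm) monoid_scheme" and K :: "('b, 'n) monoid_scheme"
  assumes "free_group G" "G \<cong> K" "group G"
  shows "free_group K"
proof -
  obtain X :: "'a set" where X: "G \<cong> free_group_on X" using assms(1) unfolding free_group_def by blast
  have "free_group_on X \<cong> K"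
    using group.iso_sym[OF assms(3) X] assms(2) by (rule iso_trans)
  then obtain \<phi> where \<phi>: "\<phi> \<in> iso (free_group_on X) K" unfolding is_iso_def by blast
  then have "inj_on \<phi> (carrier (free_group_on X))" by (simp add: iso_def bij_betw_def)
  then have inj: "inj_on (\<phi> \<circ> free_generator X) X"
    by (intro comp_inj_on free_generator_inj)
      (auto elim!: inj_on_subset intro: free_generator_closed)
  have "K \<cong> G" by (rule group.iso_sym[OF assms(3,2)])
  also note X
  also note free_group_on_relabel[OF inj]
  finally have "K \<cong> free_group_on ((\<phi> \<circ> free_generator X) ` X)" .
  then show ?thesis unfolding free_group_def by blast
qed

text \<open>A criterion for freeness on a generating set \<open>X\<close> that avoids reduced words: if the group acts on a set
  containing a copy of the free group on \<open>X\<close> in such a way that every \<open>x\<close> in \<open>X\<close> acts on the copy as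
  left multiplication by the generator \<open>x\<close>, then the value in \<open>K\<close> of an element \<open>c\<close> of the free group
  moves the copy of the identity to the copy of \<open>c\<close>.  Hence \<open>c\<close> is determined by its value.\<close>

lemma free_groupI:
  fixes K :: "('a, 'm) monoid_scheme"
  assumes "group K" and X: "X \<subseteq> carrier K" and gen: "carrier K \<subseteq> generate K X"
    and act_one: "\<And>s. s \<in> S \<Longrightarrow> act \<one>\<^bsub>K\<^esub> s = s"
    and act_mult: "\<And>x y s. x \<in> carrier K \<Longrightarrow> y \<in> carrier K \<Longrightarrow> s \<in> S \<Longrightarrow>
       act (x \<otimes>\<^bsub>K\<^esub> y) s = act x (act y s)"
    and j: "inj_on j (carrier (free_group_on X))" "j ` carrier (free_group_on X) \<subseteq> S"
    and act_gen: "\<And>x c. x \<in> X \<Longrightarrow> c \<in> carrier (free_group_on X) \<Longrightarrow>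
       act x (j c) = j (free_generator X x \<otimes>\<^bsub>free_group_on X\<^esub> c)"
  shows "free_group K"
proof -
  let ?F = "free_group_on X"
  interpret K: group K by fact
  interpret F: group ?F by (rule group_free_group_on)
  obtain \<psi> where \<psi>: "\<psi> \<in> hom ?F K" "\<And>x. x \<in> X \<Longrightarrow> \<psi> (free_generator X x) = x"
    using free_group_on_lift[OF assms(1), of id X] X by auto
  interpret \<psi>: group_hom ?F K \<psi>
    by unfold_locales (rule \<psi>(1))
  have jS: "j c \<in> S" if "c \<in> carrier ?F" for c using j(2) that by blast
  have act_inv: "act (inv\<^bsub>K\<^esub> x) (j c) = j (inv\<^bsub>?F\<^esub> free_generator X x \<otimes>\<^bsub>?F\<^esub> c)"
    if x: "x \<in> X" and c: "c \<in> carrier ?F" for x c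
  proof -
    let ?g = "free_generator X x" and ?d = "inv\<^bsub>?F\<^esub> free_generator X x \<otimes>\<^bsub>?F\<^esub> c"
    have g: "?g \<in> carrier ?F" using x by (rule free_generator_closed)
    have xK: "x \<in> carrier K" using x X by blast
    have d: "?d \<in> carrier ?F" using g c by simp
    have "act (inv\<^bsub>K\<^esub> x) (act x (j ?d)) = j ?d"
      using act_mult[of "inv\<^bsub>K\<^esub> x" x "j ?d"] act_one[OF jS[OF d]] xK jS[OF d] by simp
    then show ?thesis
      using act_gen[OF x d] g c by (simp add: F.inv_solve_left F.m_assoc[symmetric])
  qed
  have act: "act (\<psi> c) (j \<one>\<^bsub>?F\<^esub>) = j c" if "c \<in> carrier ?F" for c
    using that
  proof (rule free_group_on_induct)
    show "act (\<psi> \<one>\<^bsub>?F\<^esub>) (j \<one>\<^bsub>?F\<^esub>) = j \<one>\<^bsub>?F\<^esub>" using act_one jS by simp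
  next
    fix x d assume x: "x \<in> X" and d: "d \<in> carrier ?F" "act (\<psi> d) (j \<one>\<^bsub>?F\<^esub>) = j d"
    have g: "free_generator X x \<in> carrier ?F" "x \<in> carrier K"
      using free_generator_closed[OF x] x X by auto
    show "act (\<psi> (free_generator X x \<otimes>\<^bsub>?F\<^esub> d)) (j \<one>\<^bsub>?F\<^esub>) = j (free_generator X x \<otimes>\<^bsub>?F\<^esub> d)"
      "act (\<psi> (inv\<^bsub>?F\<^esub> free_generator X x \<otimes>\<^bsub>?F\<^esub> d)) (j \<one>\<^bsub>?F\<^esub>) = j (inv\<^bsub>?F\<^esub> free_generator X x \<otimes>\<^bsub>?F\<^esub> d)"
      using x d g by (simp_all add: \<psi>(2) act_mult jS act_gen act_inv)
  qed
  have "inj_on \<psi> (carrier ?F)"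
  proof (rule inj_onI)
    fix c d assume cd: "c \<in> carrier ?F" "d \<in> carrier ?F" "\<psi> c = \<psi> d"
    then have "j c = j d" using act[OF cd(1)] act[OF cd(2)] by simp
    then show "c = d" using cd j(1) by (simp add: inj_on_eq_iff)
  qed
  moreover have "\<psi> ` carrier ?F = carrier K"
  proof
    have "X \<subseteq> \<psi> ` carrier ?F" using \<psi>(2) free_generator_closed by (metis image_eqI subsetI)
    then have "generate K X \<subseteq> \<psi> ` carrier ?F"
      by (rule K.generate_subgroup_incl) (rule \<psi>.img_is_subgroup)
    then show "carrier K \<subseteq> \<psi> ` carrier ?F" using gen by blast
  qed (use \<psi>.hom_closed in blast)
  ultimately have "\<psi> \<in> iso ?F K"
    using \<psi>(1) by (simp add: iso_def bij_betw_def)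
  then have "?F \<cong> K" by (rule is_isoI)
  then have "K \<cong> ?F" by (rule F.iso_sym)
  then show ?thesis unfolding free_group_def by blast
qed

section \<open>Poly-free groups\<close>

lemma free_imp_poly_free:
  assumes "group G" "free_group G"
  shows "poly_free G"
proof -
  interpret group G by fact
  have "group (G Mod {\<one>\<^bsub>G\<^esub>})" by (intro normal.factorgroup_is_group one_is_normal)
  have "G Mod {\<one>\<^bsub>G\<^esub>} \<cong> G" by (rule is_isoI[OF trivial_factor_iso])
  then have "G \<cong> G Mod {\<one>\<^bsub>G\<^esub>}" by (rule group.iso_sym[OF \<open>group (G Mod _)\<close>])
  then have "free_group (G Mod {\<one>\<^bsub>G\<^esub>})" by (rule free_group_iso[OF assms(2) _ assms(1)])
  then show ?thesis
    unfolding poly_free_def using assms(1)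
    by (intro conjI exI[of _ "1::nat"] exI[of _ "\<lambda>k::nat. if k = 0 then {\<one>\<^bsub>G\<^esub>} else carrier G"])
      (auto simp: one_is_normal triv_subgroup subgroup_self)
qed

lemma trivial_imp_poly_free:
  assumes "group G" "carrier G = {\<one>\<^bsub>G\<^esub>}"
  shows "poly_free G"
  unfolding poly_free_def using assms group.triv_subgroup[of G]
  by (intro conjI exI[of _ "0::nat"] exI[of _ "\<lambda>_. {\<one>\<^bsub>G\<^esub>}"]) auto

text \<open>Both parts hold because the preimage of \<open>N\<close> is the kernel of \<open>\<pi>\<close> followed by the projection onto the
  quotient by \<open>N\<close>.  It moves the quotients of a subnormal chain along an epimorphism.\<close>

lemma quotient_preimage_iso:
  assumes "group G" "group Q" "\<pi> \<in> hom G Q" "\<pi> ` carrier G = carrier Q" "N \<lhd> Q"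
  shows "{x \<in> carrier G. \<pi> x \<in> N} \<lhd> G"
    and "G Mod {x \<in> carrier G. \<pi> x \<in> N} \<cong> Q Mod N"
proof -
  interpret G: group G by fact
  interpret Q: group Q by fact
  interpret N: normal N Q by fact
  interpret M: group "Q Mod N" by (rule N.factorgroup_is_group)
  let ?\<theta> = "(\<lambda>y. N #>\<^bsub>Q\<^esub> y) \<circ> \<pi>"
  have \<pi>: "\<pi> x \<in> carrier Q" if "x \<in> carrier G" for x using assms(4) that by blast
  interpret \<theta>: group_hom G "Q Mod N" ?\<theta>
    by unfold_locales (rule hom_compose[OF assms(3) N.r_coset_hom_Mod])
  have "kernel G (Q Mod N) ?\<theta> = {x \<in> carrier G. \<pi> x \<in> N}"
    using Q.coset_join1[OF _ \<pi> N.subgroup_axioms] Q.coset_join2[OF \<pi> N.subgroup_axioms]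
    by (fastforce simp: kernel_def FactGroup_def)
  moreover have "?\<theta> ` carrier G = carrier (Q Mod N)"
    unfolding image_comp[symmetric] assms(4) by (auto simp: FactGroup_def RCOSETS_def)
  ultimately show "{x \<in> carrier G. \<pi> x \<in> N} \<lhd> G"
    and "G Mod {x \<in> carrier G. \<pi> x \<in> N} \<cong> Q Mod N"
    using \<theta>.normal_kernel \<theta>.FactGroup_iso by simp_all
qed

text \<open>A chain for the kernel is continued by the preimages of a chain for \<open>Q\<close>; the two meet in the kernel
  itself, which is the preimage of the trivial group.\<close>

lemma poly_free_extension:
  fixes G :: "('a, 'm) monoid_scheme" and Q :: "('b, 'n) monoid_scheme"
  assumes "group G" and \<pi>: "\<pi> \<in> hom G Q" and surj: "\<pi> ` carrier G = carrier Q"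
    and Q: "poly_free Q" and ker: "poly_free (G\<lparr>carrier := kernel G Q \<pi>\<rparr>)"
  shows "poly_free G"
proof -
  interpret G: group G by fact
  interpret Q: group Q using Q by (simp add: poly_free_def)
  interpret \<pi>: group_hom G Q \<pi> by unfold_locales (rule \<pi>)
  let ?K = "kernel G Q \<pi>"
  obtain n A where A: "A 0 = {\<one>\<^bsub>G\<^esub>}" "A n = ?K" "\<And>k. k \<le> n \<Longrightarrow> subgroup (A k) (G\<lparr>carrier := ?K\<rparr>)"
    "\<And>k. k < n \<Longrightarrow> A k \<lhd> G\<lparr>carrier := A (Suc k)\<rparr>"
    "\<And>k. k < n \<Longrightarrow> free_group (G\<lparr>carrier := A (Suc k)\<rparr> Mod A k)"
    using ker unfolding poly_free_def by auto
  obtain m B where B: "B 0 = {\<one>\<^bsub>Q\<^esub>}" "B m = carrier Q" "\<And>k. k \<le> m \<Longrightarrow> subgroup (B k) Q"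
    "\<And>k. k < m \<Longrightarrow> B k \<lhd> Q\<lparr>carrier := B (Suc k)\<rparr>"
    "\<And>k. k < m \<Longrightarrow> free_group (Q\<lparr>carrier := B (Suc k)\<rparr> Mod B k)"
    using Q unfolding poly_free_def by auto
  define P where "P k = {x \<in> carrier G. \<pi> x \<in> B k}" for k
  have Psub: "subgroup (P k) G" if "k \<le> m" for k
  proof -
    interpret B: subgroup "B k" Q using that by (rule B(3))
    show ?thesis by (rule G.subgroupI) (auto simp: P_def intro!: exI[of _ "\<one>\<^bsub>G\<^esub>"])
  qed
  have P: "P k \<lhd> G\<lparr>carrier := P (Suc k)\<rparr> \<and> free_group (G\<lparr>carrier := P (Suc k)\<rparr> Mod P k)"
    if "k < m" for k
  proof -
    let ?G' = "G\<lparr>carrier := P (Suc k)\<rparr>" and ?Q' = "Q\<lparr>carrier := B (Suc k)\<rparr>"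
    have B': "subgroup (B (Suc k)) Q" "B (Suc k) \<subseteq> carrier Q" "subgroup (B k) ?Q'" "B k \<subseteq> B (Suc k)"
      using B(3)[of "Suc k"] that normal_imp_subgroup[OF B(4)[OF that]]
        subgroup.subset[OF B(3)[of "Suc k"]] subgroup.subset[OF normal_imp_subgroup[OF B(4)[OF that]]]
      by simp_all
    have gr: "group ?G'" "group ?Q'"
      by (rule G.subgroup_imp_group[OF Psub], use that in simp, rule Q.subgroup_imp_group[OF B'(1)])
    have \<pi>': "\<pi> \<in> hom ?G' ?Q'" by (auto simp: hom_def P_def)
    have im: "\<pi> ` carrier ?G' = carrier ?Q'"
    proof
      show "carrier ?Q' \<subseteq> \<pi> ` carrier ?G'"
      proof
        fix y assume y: "y \<in> carrier ?Q'"
        then have "y \<in> \<pi> ` carrier G" using B'(2) surj by auto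
        then show "y \<in> \<pi> ` carrier ?G'" using y by (auto simp: P_def)
      qed
    qed (auto simp: P_def)
    have eq: "{x \<in> carrier ?G'. \<pi> x \<in> B k} = P k" using B'(4) by (auto simp: P_def)
    note qp = quotient_preimage_iso[OF gr \<pi>' im B(4)[OF that], unfolded eq]
    have "group (?Q' Mod B k)" using B(4)[OF that] by (rule normal.factorgroup_is_group)
    moreover have "group (?G' Mod P k)" using qp(1) by (rule normal.factorgroup_is_group)
    ultimately have "free_group (?G' Mod P k)"
      using free_group_iso[OF B(5)[OF that]] group.iso_sym[OF _ qp(2)] by blast
    then show ?thesis using qp(1) by blast
  qed
  define H where "H k = (if k \<le> n then A k else P (k - n))" for k
  have P0: "P 0 = ?K" by (auto simp: P_def B(1) kernel_def)
  have HP: "H (n + k) = P k" for k by (cases k) (auto simp: H_def A(2) P0)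
  have sub: "subgroup (H k) G" if "k \<le> n + m" for k
    using A(3) Psub that G.incl_subgroup[OF \<pi>.subgroup_kernel] by (auto simp: H_def)
  have step: "H k \<lhd> G\<lparr>carrier := H (Suc k)\<rparr> \<and> free_group (G\<lparr>carrier := H (Suc k)\<rparr> Mod H k)"
    if "k < n + m" for k
  proof (cases "k < n")
    case True
    then show ?thesis using A(4,5) by (simp add: H_def)
  next
    case False
    then obtain l where l: "k = n + l" by (metis le_Suc_ex not_less)
    then have "l < m" using that by simp
    then show ?thesis using P[of l] HP[of l] HP[of "Suc l"] l by simp
  qed
  have "H 0 = {\<one>\<^bsub>G\<^esub>}" by (simp add: H_def A(1))
  moreover have "H (n + m) = carrier G" using HP[of m] B(2) by (auto simp: P_def)
  ultimately show ?thesis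
    unfolding poly_free_def using sub step G.group_axioms by blast
qed

section \<open>Graph products\<close>

lemma (in group) cancel_left:
  assumes "x \<in> carrier G" "y \<in> carrier G"
  shows "inv x \<otimes> (x \<otimes> y) = y" "x \<otimes> (inv x \<otimes> y) = y"
  using assms by (simp_all flip: m_assoc)

locale graph_of_groups =
  fixes V :: "'i set" and E :: "'i set set" and G :: "'i \<Rightarrow> ('a, 'm) monoid_scheme"
  assumes graph: "finite_simplicial_graph V E"
    and groups: "\<And>i. i \<in> V \<Longrightarrow> group (G i)"
begin

abbreviation \<Gamma> :: "('i \<times> 'a) list set set monoid" where
  "\<Gamma> \<equiv> graph_product V E G"

abbreviation incl :: "'i \<Rightarrow> 'a \<Rightarrow> ('i \<times> 'a) list set set" where
  "incl \<equiv> graph_product_incl V E G"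

abbreviation relations :: "('i \<times> 'a) list set set" where
  "relations \<equiv> normal_closure (free_product V G) (graph_relators V E G)"

sublocale \<Gamma>: group \<Gamma>
  using graph groups by (rule group_graph_product)

sublocale free_prod: group "free_product V G"
  using groups by (rule group_free_product)

sublocale relations: normal relations "free_product V G"
  by (rule normal_normal_closure[OF free_prod.group_axioms graph_relators_closed[OF graph groups]])

lemma edge_vertices:
  assumes "{i, j} \<in> E"
  shows "i \<in> V" "j \<in> V" "i \<noteq> j"
proof -
  have "{i, j} \<subseteq> V" "card {i, j} = 2"
    using assms graph by (auto simp: finite_simplicial_graph_def)
  then show "i \<in> V" "j \<in> V" "i \<noteq> j" by auto
qed

lemma free_product_incl_mult:
  assumes "i \<in> V" "g \<in> carrier (G i)" "h \<in> carrier (G i)"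
  shows "free_product_incl V G i (g \<otimes>\<^bsub>G i\<^esub> h) =
    free_product_incl V G i g \<otimes>\<^bsub>free_product V G\<^esub> free_product_incl V G i h"
proof -
  let ?A = "free_product_letters V G" and ?R = "free_product_rels V G"
  have gh: "g \<otimes>\<^bsub>G i\<^esub> h \<in> carrier (G i)"
    using assms groups by (simp add: group.is_monoid monoid.m_closed)
  have l: "[(i, g)] \<in> lists ?A" "[(i, h)] \<in> lists ?A" "[(i, g), (i, h)] \<in> lists ?A"
    "[(i, g \<otimes>\<^bsub>G i\<^esub> h)] \<in> lists ?A"
    using assms gh by (simp_all add: free_product_letters_def)
  have "([(i, g), (i, h)], [(i, g \<otimes>\<^bsub>G i\<^esub> h)]) \<in> ?R"
    using assms by (auto simp: free_product_rels_def)
  from word_cong.step[OF this, of "[]" "[]" ?A] l(3,4)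
  have "([(i, g), (i, h)], [(i, g \<otimes>\<^bsub>G i\<^esub> h)]) \<in> word_cong ?A ?R"
    by (simp only: append_Nil append_Nil2)
  then have "word_class ?A ?R [(i, g), (i, h)] = word_class ?A ?R [(i, g \<otimes>\<^bsub>G i\<^esub> h)]"
    using word_class_eq_iff[OF l(3,4)] by blast
  then show ?thesis
    unfolding free_product_incl_def free_product_def mult_presented_monoid[OF l(1,2)] by simp
qed

lemma incl_hom:
  assumes "i \<in> V"
  shows "incl i \<in> hom (G i) \<Gamma>"
proof -
  have "incl i = (\<lambda>x. relations #>\<^bsub>free_product V G\<^esub> x) \<circ> free_product_incl V G i"
    by (auto simp: graph_product_incl_def)
  moreover have "free_product_incl V G i \<in> hom (G i) (free_product V G)"
    using assms by (intro homI free_product_incl_closed free_product_incl_mult)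
  ultimately show ?thesis
    using relations.r_coset_hom_Mod unfolding graph_product_def by (auto intro: hom_compose)
qed

lemma incl_closed [simp, intro]: "i \<in> V \<Longrightarrow> g \<in> carrier (G i) \<Longrightarrow> incl i g \<in> carrier \<Gamma>"
  using incl_hom by (blast intro: hom_in_carrier)

lemma incl_mult:
  "i \<in> V \<Longrightarrow> g \<in> carrier (G i) \<Longrightarrow> h \<in> carrier (G i) \<Longrightarrow>
    incl i (g \<otimes>\<^bsub>G i\<^esub> h) = incl i g \<otimes>\<^bsub>\<Gamma>\<^esub> incl i h"
  using hom_mult[OF incl_hom] .

lemma incl_one: "i \<in> V \<Longrightarrow> incl i \<one>\<^bsub>G i\<^esub> = \<one>\<^bsub>\<Gamma>\<^esub>"
  using hom_one[OF incl_hom groups \<Gamma>.group_axioms] by blast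

lemma incl_commute:
  assumes "{i, j} \<in> E" "g \<in> carrier (G i)" "h \<in> carrier (G j)"
  shows "incl i g \<otimes>\<^bsub>\<Gamma>\<^esub> incl j h = incl j h \<otimes>\<^bsub>\<Gamma>\<^esub> incl i g"
proof -
  let ?F = "free_product V G"
  let ?x = "free_product_incl V G i g" and ?y = "free_product_incl V G j h"
  have xy: "?x \<in> carrier ?F" "?y \<in> carrier ?F"
    using edge_vertices[OF assms(1)] assms(2,3) by (auto intro: free_product_incl_closed)
  have "commutator ?F ?x ?y \<in> graph_relators V E G"
    using assms unfolding graph_relators_def by blast
  then have c: "commutator ?F ?x ?y \<in> relations"
    unfolding normal_closure_def by blast
  have eq: "?x \<otimes>\<^bsub>?F\<^esub> ?y = commutator ?F ?x ?y \<otimes>\<^bsub>?F\<^esub> (?y \<otimes>\<^bsub>?F\<^esub> ?x)"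
    using xy by (simp add: commutator_def free_prod.m_assoc free_prod.cancel_left)
  have "relations #>\<^bsub>?F\<^esub> (?x \<otimes>\<^bsub>?F\<^esub> ?y) = relations #>\<^bsub>?F\<^esub> commutator ?F ?x ?y #>\<^bsub>?F\<^esub> (?y \<otimes>\<^bsub>?F\<^esub> ?x)"
    unfolding eq using xy c relations.subset
    by (intro free_prod.coset_mult_assoc[symmetric]) auto
  also have "relations #>\<^bsub>?F\<^esub> commutator ?F ?x ?y = relations"
    using c relations.mem_carrier by (intro free_prod.coset_join2 relations.subgroup_axioms)
  finally show ?thesis
    using xy by (simp add: graph_product_incl_def graph_product_def FactGroup_def relations.rcos_sum)
qed

text \<open>Every element is a product of elements of the vertex groups, since these contain the inverses of their
  elements.\<close>

lemma graph_product_induct [consumes 1, case_names one step]: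
  assumes x: "x \<in> carrier \<Gamma>"
    and one: "P \<one>\<^bsub>\<Gamma>\<^esub>"
    and step: "\<And>i g y. i \<in> V \<Longrightarrow> g \<in> carrier (G i) \<Longrightarrow> y \<in> carrier \<Gamma> \<Longrightarrow> P y \<Longrightarrow> P (incl i g \<otimes>\<^bsub>\<Gamma>\<^esub> y)"
  shows "P x"
proof -
  let ?F = "free_product V G" and ?q = "\<lambda>y. relations #>\<^bsub>free_product V G\<^esub> y"
  obtain c where c: "c \<in> carrier ?F" "x = ?q c"
    using x by (auto simp: graph_product_def FactGroup_def RCOSETS_def)
  interpret q: group_hom ?F \<Gamma> ?q
    unfolding graph_product_def
    by (intro group_hom.intro group_hom_axioms.intro relations.r_coset_hom_Mod free_prod.group_axioms
        relations.factorgroup_is_group)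
  have "P (?q c)"
    using c(1) unfolding free_product_def
  proof (rule presented_monoid_induct, fold free_product_def)
    show "P (?q \<one>\<^bsub>?F\<^esub>)" using one by simp
  next
    fix p d assume "p \<in> free_product_letters V G" and d: "d \<in> carrier ?F" "P (?q d)"
    then obtain i g where p: "p = (i, g)" "i \<in> V" "g \<in> carrier (G i)"
      by (auto simp: free_product_letters_def)
    have "P (incl i g \<otimes>\<^bsub>\<Gamma>\<^esub> ?q d)" using p d by (intro step q.hom_closed)
    also have "incl i g \<otimes>\<^bsub>\<Gamma>\<^esub> ?q d = ?q (free_product_incl V G i g \<otimes>\<^bsub>?F\<^esub> d)"
      unfolding graph_product_incl_def
      using free_product_incl_closed[where V = V and G = G, OF p(2,3)] d by (intro q.hom_mult[symmetric])
    finally show "P (?q (word_class (free_product_letters V G) (free_product_rels V G) [p] \<otimes>\<^bsub>?F\<^esub> d))"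
      by (simp add: free_product_incl_def p(1))
  qed
  then show ?thesis using c by simp
qed

text \<open>The universal property: homomorphisms on the vertex groups extend to the free product by evaluating words,
  and the extension kills the relators as soon as the images of adjacent vertex groups commute.\<close>

lemma graph_product_lift:
  assumes "group H" and f: "\<And>i. i \<in> V \<Longrightarrow> f i \<in> hom (G i) H"
    and comm: "\<And>i j g h. {i, j} \<in> E \<Longrightarrow> g \<in> carrier (G i) \<Longrightarrow> h \<in> carrier (G j) \<Longrightarrow>
       f i g \<otimes>\<^bsub>H\<^esub> f j h = f j h \<otimes>\<^bsub>H\<^esub> f i g"
  obtains \<Phi> where "\<Phi> \<in> hom \<Gamma> H"
    and "\<And>i g. i \<in> V \<Longrightarrow> g \<in> carrier (G i) \<Longrightarrow> \<Phi> (incl i g) = f i g"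
proof -
  interpret H: group H by fact
  let ?F = "free_product V G" and ?A = "free_product_letters V G" and ?R = "free_product_rels V G"
  let ?f = "\<lambda>(i, g). f i g"
  have fc: "f i g \<in> carrier H" if "i \<in> V" "g \<in> carrier (G i)" for i g
    using f that by (blast intro: hom_in_carrier)
  have f1: "f i \<one>\<^bsub>G i\<^esub> = \<one>\<^bsub>H\<^esub>" if "i \<in> V" for i
    using hom_one[OF f groups H.group_axioms] that by blast
  have fA: "?f ` ?A \<subseteq> carrier H" using fc by (auto simp: free_product_letters_def)
  have R: "?R \<subseteq> lists ?A \<times> lists ?A"
    using groups by (auto simp: free_product_rels_def free_product_letters_def
        group.is_monoid monoid.one_closed monoid.m_closed)
  have rel: "word_eval H ?f l = word_eval H ?f r" if "(l, r) \<in> ?R" for l r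
    using that fc f1 hom_mult[OF f] groups
    by (auto simp: free_product_rels_def word_eval_def group.is_monoid monoid.m_closed H.m_assoc)
  obtain \<phi> where \<phi>: "\<phi> \<in> hom ?F H" "\<And>u. u \<in> lists ?A \<Longrightarrow> \<phi> (word_class ?A ?R u) = word_eval H ?f u"
    by (rule presented_monoid_lift[OF H.is_monoid fA R])
      (use rel that in \<open>unfold free_product_def; blast\<close>)+
  interpret \<phi>: group_hom ?F H \<phi> by unfold_locales (rule \<phi>(1))
  have \<phi>_incl: "\<phi> (free_product_incl V G i g) = f i g" if "i \<in> V" "g \<in> carrier (G i)" for i g
  proof -
    have "[(i, g)] \<in> lists ?A" using that by (simp add: free_product_letters_def)
    then show ?thesis
      unfolding free_product_incl_def using fc[OF that] by (subst \<phi>(2)) (simp_all add: word_eval_def)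
  qed
  have "\<phi> r = \<one>\<^bsub>H\<^esub>" if r_in: "r \<in> graph_relators V E G" for r
  proof -
    obtain i j g h where r: "r = commutator ?F (free_product_incl V G i g) (free_product_incl V G j h)"
      and e: "{i, j} \<in> E" and gh: "g \<in> carrier (G i)" "h \<in> carrier (G j)"
      using r_in unfolding graph_relators_def by blast
    note v = edge_vertices[OF e]
    have "\<phi> r = f i g \<otimes>\<^bsub>H\<^esub> f j h \<otimes>\<^bsub>H\<^esub> inv\<^bsub>H\<^esub> f i g \<otimes>\<^bsub>H\<^esub> inv\<^bsub>H\<^esub> f j h"
      using gh v by (simp add: r commutator_def \<phi>_incl free_product_incl_closed)
    also have "\<dots> = \<one>\<^bsub>H\<^esub>"
      using fc v gh by (simp add: comm[OF e gh] H.m_assoc)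
    finally show ?thesis .
  qed
  then have "graph_relators V E G \<subseteq> kernel ?F H \<phi>"
    using graph_relators_closed[where G = G, OF graph groups] by (auto simp: kernel_def)
  then have "relations \<subseteq> kernel ?F H \<phi>"
    unfolding normal_closure_def using \<phi>.normal_kernel by blast
  then obtain \<Phi> where \<Phi>: "\<Phi> \<in> hom \<Gamma> H"
    "\<And>x. x \<in> carrier ?F \<Longrightarrow> \<Phi> (relations #>\<^bsub>?F\<^esub> x) = \<phi> x"
    using \<phi>.FactGroup_universal_kernel[OF relations.normal_axioms] unfolding graph_product_def by blast
  show ?thesis
    by (rule that[OF \<Phi>(1)])
      (simp add: graph_product_incl_def \<Phi>(2) free_product_incl_closed \<phi>_incl)
qed

lemma graph_of_groups_subset: "W \<subseteq> V \<Longrightarrow> graph_of_groups W {e \<in> E. e \<subseteq> W} G"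
  using graph groups by (intro graph_of_groups.intro) (auto simp: finite_simplicial_graph_def intro: finite_subset)

end

text \<open>Turns an action given by a formula on points into a homomorphism, the form in which the universal property
  of graph products takes it.  Restricting to \<open>S\<close> makes the bijections extensional.\<close>

lemma BijGroup_homI:
  assumes "group K"
    and closed: "\<And>x s. x \<in> carrier K \<Longrightarrow> s \<in> S \<Longrightarrow> act x s \<in> S"
    and one: "\<And>s. s \<in> S \<Longrightarrow> act \<one>\<^bsub>K\<^esub> s = s"
    and mult: "\<And>x y s. x \<in> carrier K \<Longrightarrow> y \<in> carrier K \<Longrightarrow> s \<in> S \<Longrightarrow>
       act (x \<otimes>\<^bsub>K\<^esub> y) s = act x (act y s)"
  shows "(\<lambda>x. \<lambda>s\<in>S. act x s) \<in> hom K (BijGroup S)"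
proof -
  interpret K: group K by fact
  have inv: "act x (act (inv\<^bsub>K\<^esub> x) s) = s" "act (inv\<^bsub>K\<^esub> x) (act x s) = s"
    if "x \<in> carrier K" "s \<in> S" for x s
    using that one mult[of x "inv\<^bsub>K\<^esub> x" s] mult[of "inv\<^bsub>K\<^esub> x" x s] by simp_all
  have Bij: "(\<lambda>s\<in>S. act x s) \<in> Bij S" if "x \<in> carrier K" for x
  proof -
    have "bij_betw (act x) S S"
      using that closed inv by (intro bij_betw_byWitness[of S "act (inv\<^bsub>K\<^esub> x)"]) auto
    then show ?thesis by (simp add: Bij_def)
  qed
  show ?thesis
    by (rule homI) (auto simp: BijGroup_def Bij compose_def mult closed intro!: restrict_ext)
qed

section \<open>Splitting off a vertex\<close>

text \<open>The maps that split off the vertex \<open>v\<close>: the retraction \<open>\<rho>\<close> onto the graph product over the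
  remaining vertices, its section \<open>\<iota>\<close>, and the projection \<open>\<sigma>\<close> onto \<open>G v\<close>.  Each of them is determined by
  its values on the vertex groups.\<close>

locale vertex_splitting = graph_of_groups V E G
  for V :: "'i set" and E :: "'i set set" and G :: "'i \<Rightarrow> ('a, 'm) monoid_scheme" +
  fixes v :: 'i
    and \<rho> :: "('i \<times> 'a) list set set \<Rightarrow> ('i \<times> 'a) list set set"
    and \<iota> :: "('i \<times> 'a) list set set \<Rightarrow> ('i \<times> 'a) list set set"
    and \<sigma> :: "('i \<times> 'a) list set set \<Rightarrow> 'a"
  assumes v: "v \<in> V"
    and \<rho>_hom: "\<rho> \<in> hom (graph_product V E G) (graph_product (V - {v}) {e \<in> E. e \<subseteq> V - {v}} G)"
    and \<rho>_v: "\<And>g. g \<in> carrier (G v) \<Longrightarrow>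
      \<rho> (graph_product_incl V E G v g) = \<one>\<^bsub>graph_product (V - {v}) {e \<in> E. e \<subseteq> V - {v}} G\<^esub>"
    and \<rho>_incl: "\<And>i g. i \<in> V - {v} \<Longrightarrow> g \<in> carrier (G i) \<Longrightarrow>
      \<rho> (graph_product_incl V E G i g) = graph_product_incl (V - {v}) {e \<in> E. e \<subseteq> V - {v}} G i g"
    and \<iota>_hom: "\<iota> \<in> hom (graph_product (V - {v}) {e \<in> E. e \<subseteq> V - {v}} G) (graph_product V E G)"
    and \<iota>_incl: "\<And>i g. i \<in> V - {v} \<Longrightarrow> g \<in> carrier (G i) \<Longrightarrow>
      \<iota> (graph_product_incl (V - {v}) {e \<in> E. e \<subseteq> V - {v}} G i g) = graph_product_incl V E G i g"
    and \<sigma>_hom: "\<sigma> \<in> hom (graph_product V E G) (G v)"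
    and \<sigma>_v: "\<And>g. g \<in> carrier (G v) \<Longrightarrow> \<sigma> (graph_product_incl V E G v g) = g"
    and \<sigma>_incl: "\<And>i g. i \<in> V - {v} \<Longrightarrow> g \<in> carrier (G i) \<Longrightarrow>
      \<sigma> (graph_product_incl V E G i g) = \<one>\<^bsub>G v\<^esub>"
begin

sublocale W: graph_of_groups "V - {v}" "{e \<in> E. e \<subseteq> V - {v}}" G
  by (rule graph_of_groups_subset) simp

sublocale Gv: group "G v"
  using v by (rule groups)

sublocale \<rho>: group_hom \<Gamma> W.\<Gamma> \<rho>
  by unfold_locales (rule \<rho>_hom)

sublocale \<iota>: group_hom W.\<Gamma> \<Gamma> \<iota>
  by unfold_locales (rule \<iota>_hom)

sublocale \<sigma>: group_hom \<Gamma> "G v" \<sigma>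
  by unfold_locales (rule \<sigma>_hom)

lemma \<rho>_\<iota>: "w \<in> carrier W.\<Gamma> \<Longrightarrow> \<rho> (\<iota> w) = w"
  by (induction rule: W.graph_product_induct) (simp_all add: \<iota>_incl \<rho>_incl)

lemma \<sigma>_\<iota>: "w \<in> carrier W.\<Gamma> \<Longrightarrow> \<sigma> (\<iota> w) = \<one>\<^bsub>G v\<^esub>"
  by (induction rule: W.graph_product_induct) (simp_all add: \<iota>_incl \<sigma>_incl)

definition free_part :: "('i \<times> 'a) list set set set" where
  "free_part = {x \<in> carrier \<Gamma>. \<rho> x = \<one>\<^bsub>W.\<Gamma>\<^esub> \<and> \<sigma> x = \<one>\<^bsub>G v\<^esub>}"

text \<open>The correction term that arises when an element of \<open>G v\<close> is moved past \<open>w\<close> in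
  \<open>move_past_\<iota>\<close>.\<close>

definition basis_elt :: "('i \<times> 'a) list set set \<Rightarrow> 'a \<Rightarrow> ('i \<times> 'a) list set set" where
  "basis_elt w g = inv\<^bsub>\<Gamma>\<^esub> incl v g \<otimes>\<^bsub>\<Gamma>\<^esub> (inv\<^bsub>\<Gamma>\<^esub> \<iota> w \<otimes>\<^bsub>\<Gamma>\<^esub> (incl v g \<otimes>\<^bsub>\<Gamma>\<^esub> \<iota> w))"

text \<open>Different pairs \<open>(w, g)\<close> may give the same element, for instance when the first components differ by a left
  factor from the link of \<open>v\<close>.  Taking the set of values as the basis, rather than the pairs, makes these
  coincidences harmless and dispenses with coset representatives for the link.\<close>

definition basis :: "('i \<times> 'a) list set set set" where
  "basis = {basis_elt w g | w g. w \<in> carrier W.\<Gamma> \<and> g \<in> carrier (G v)} - {\<one>\<^bsub>\<Gamma>\<^esub>}"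

lemma subgroup_free_part: "subgroup free_part \<Gamma>"
proof -
  have "free_part = kernel \<Gamma> W.\<Gamma> \<rho> \<inter> kernel \<Gamma> (G v) \<sigma>" by (auto simp: free_part_def kernel_def)
  then show ?thesis
    by (simp add: \<Gamma>.subgroups_Inter_pair \<rho>.subgroup_kernel \<sigma>.subgroup_kernel)
qed

lemma basis_elt_in_free_part:
  assumes "w \<in> carrier W.\<Gamma>" "g \<in> carrier (G v)"
  shows "basis_elt w g \<in> free_part"
  using assms v
  by (simp add: free_part_def basis_elt_def \<rho>_v \<sigma>_v \<rho>_\<iota> \<sigma>_\<iota>)

lemma basis_subset_free_part: "basis \<subseteq> free_part"
  using basis_elt_in_free_part by (auto simp: basis_def)

lemma basis_elt_one:
  "g \<in> carrier (G v) \<Longrightarrow> basis_elt \<one>\<^bsub>W.\<Gamma>\<^esub> g = \<one>\<^bsub>\<Gamma>\<^esub>"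
  "w \<in> carrier W.\<Gamma> \<Longrightarrow> basis_elt w \<one>\<^bsub>G v\<^esub> = \<one>\<^bsub>\<Gamma>\<^esub>"
  using v by (simp_all add: basis_elt_def incl_one)

text \<open>An element of a vertex group adjacent to \<open>v\<close> commutes with \<open>g\<close>, so it cancels between \<open>w\<^sup>-\<^sup>1\<close> and \<open>w\<close>.
  This is what makes the action constructed below respect the edges at \<open>v\<close>.\<close>

lemma basis_elt_link:
  assumes "{v, j} \<in> E" "l \<in> carrier (G j)" "w \<in> carrier W.\<Gamma>" "g \<in> carrier (G v)"
  shows "basis_elt (W.incl j l \<otimes>\<^bsub>W.\<Gamma>\<^esub> w) g = basis_elt w g"
proof -
  note j = edge_vertices[OF assms(1)]
  have jW: "j \<in> V - {v}" using j by simp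
  have "incl v g \<otimes>\<^bsub>\<Gamma>\<^esub> (incl j l \<otimes>\<^bsub>\<Gamma>\<^esub> \<iota> w) = incl j l \<otimes>\<^bsub>\<Gamma>\<^esub> (incl v g \<otimes>\<^bsub>\<Gamma>\<^esub> \<iota> w)"
    using incl_commute[OF assms(1,4,2)] j assms by (simp flip: \<Gamma>.m_assoc)
  then show ?thesis
    using assms j jW
    by (simp add: basis_elt_def \<iota>_incl \<Gamma>.inv_mult_group \<Gamma>.m_assoc \<Gamma>.cancel_left)
qed

lemma basis_elt_in_generate:
  assumes "w \<in> carrier W.\<Gamma>" "g \<in> carrier (G v)"
  shows "basis_elt w g \<in> generate \<Gamma> basis"
proof (cases "basis_elt w g = \<one>\<^bsub>\<Gamma>\<^esub>")
  case False
  then have "basis_elt w g \<in> basis" using assms by (auto simp: basis_def)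
  then show ?thesis by (rule generate.incl)
qed (simp add: generate.one)

lemma subgroup_generate_basis: "subgroup (generate \<Gamma> basis) \<Gamma>"
  using basis_subset_free_part subgroup.subset[OF subgroup_free_part] by (intro \<Gamma>.generate_is_subgroup) blast

lemma move_past_\<iota>:
  assumes "w \<in> carrier W.\<Gamma>" "g \<in> carrier (G v)" "h \<in> carrier (G v)"
  shows "incl v h \<otimes>\<^bsub>\<Gamma>\<^esub> (\<iota> w \<otimes>\<^bsub>\<Gamma>\<^esub> incl v g) =
    \<iota> w \<otimes>\<^bsub>\<Gamma>\<^esub> (incl v (h \<otimes>\<^bsub>G v\<^esub> g) \<otimes>\<^bsub>\<Gamma>\<^esub> (basis_elt w (h \<otimes>\<^bsub>G v\<^esub> g) \<otimes>\<^bsub>\<Gamma>\<^esub> inv\<^bsub>\<Gamma>\<^esub> basis_elt w g))"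
  using assms v
  by (simp add: basis_elt_def incl_mult \<Gamma>.inv_mult_group \<Gamma>.m_assoc \<Gamma>.cancel_left)

text \<open>The set of elements of this form contains the identity and is closed under left multiplication by every
  vertex group: for the vertices other than \<open>v\<close> only the factor \<open>w\<close> changes, and for \<open>v\<close> one applies
  \<open>move_past_\<iota>\<close>.\<close>

lemma normal_form:
  assumes "x \<in> carrier \<Gamma>"
  shows "\<exists>w\<in>carrier W.\<Gamma>. \<exists>g\<in>carrier (G v). \<exists>n\<in>generate \<Gamma> basis. x = \<iota> w \<otimes>\<^bsub>\<Gamma>\<^esub> incl v g \<otimes>\<^bsub>\<Gamma>\<^esub> n"
  using assms
proof (induction rule: graph_product_induct)
  case one
  show ?case
    by (intro bexI[of _ "\<one>\<^bsub>W.\<Gamma>\<^esub>"] bexI[of _ "\<one>\<^bsub>G v\<^esub>"] bexI[of _ "\<one>\<^bsub>\<Gamma>\<^esub>"])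
      (simp_all add: incl_one v generate.one)
next
  case (step i h x)
  interpret gen: subgroup "generate \<Gamma> basis" \<Gamma> by (rule subgroup_generate_basis)
  from step.IH obtain w g n where *: "w \<in> carrier W.\<Gamma>" "g \<in> carrier (G v)" "n \<in> generate \<Gamma> basis"
    "x = \<iota> w \<otimes>\<^bsub>\<Gamma>\<^esub> incl v g \<otimes>\<^bsub>\<Gamma>\<^esub> n" by blast
  have n: "n \<in> carrier \<Gamma>" using *(3) by (rule gen.mem_carrier)
  show ?case
  proof (cases "i = v")
    case True
    let ?n = "basis_elt w (h \<otimes>\<^bsub>G v\<^esub> g) \<otimes>\<^bsub>\<Gamma>\<^esub> inv\<^bsub>\<Gamma>\<^esub> basis_elt w g \<otimes>\<^bsub>\<Gamma>\<^esub> n"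
    have h: "h \<in> carrier (G v)" using step True by simp
    have y: "basis_elt w (h \<otimes>\<^bsub>G v\<^esub> g) \<in> generate \<Gamma> basis" "basis_elt w g \<in> generate \<Gamma> basis"
      using * h by (auto intro: basis_elt_in_generate)
    have "incl v h \<otimes>\<^bsub>\<Gamma>\<^esub> x = (incl v h \<otimes>\<^bsub>\<Gamma>\<^esub> (\<iota> w \<otimes>\<^bsub>\<Gamma>\<^esub> incl v g)) \<otimes>\<^bsub>\<Gamma>\<^esub> n"
      using * h n v by (simp add: \<Gamma>.m_assoc)
    also have "\<dots> = \<iota> w \<otimes>\<^bsub>\<Gamma>\<^esub> incl v (h \<otimes>\<^bsub>G v\<^esub> g) \<otimes>\<^bsub>\<Gamma>\<^esub> ?n"
      unfolding move_past_\<iota>[OF *(1,2) h]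
      using * h n v y[THEN gen.mem_carrier] by (simp add: \<Gamma>.m_assoc)
    finally have "incl v h \<otimes>\<^bsub>\<Gamma>\<^esub> x = \<iota> w \<otimes>\<^bsub>\<Gamma>\<^esub> incl v (h \<otimes>\<^bsub>G v\<^esub> g) \<otimes>\<^bsub>\<Gamma>\<^esub> ?n" .
    moreover have "?n \<in> generate \<Gamma> basis"
      by (intro gen.m_closed gen.m_inv_closed y *(3))
    ultimately show ?thesis
      using *(1) Gv.m_closed[OF h *(2)] unfolding True by blast
  next
    case False
    then have i: "i \<in> V - {v}" using step by simp
    have "incl i h \<otimes>\<^bsub>\<Gamma>\<^esub> x = \<iota> (W.incl i h \<otimes>\<^bsub>W.\<Gamma>\<^esub> w) \<otimes>\<^bsub>\<Gamma>\<^esub> incl v g \<otimes>\<^bsub>\<Gamma>\<^esub> n"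
      using * i n v step by (simp add: \<iota>_incl \<Gamma>.m_assoc)
    then show ?thesis
      using *(2,3) W.\<Gamma>.m_closed[OF W.incl_closed[OF i step.hyps(2)] *(1)] by blast
  qed
qed

text \<open>The maps \<open>\<rho>\<close> and \<open>\<sigma>\<close> read off the factors \<open>w\<close> and \<open>g\<close> of the normal form, so for an element of
  both kernels only the third factor remains.\<close>

lemma free_part_generated: "free_part \<subseteq> generate \<Gamma> basis"
proof
  fix x assume x: "x \<in> free_part"
  then obtain w g n where *: "w \<in> carrier W.\<Gamma>" "g \<in> carrier (G v)" "n \<in> generate \<Gamma> basis"
    "x = \<iota> w \<otimes>\<^bsub>\<Gamma>\<^esub> incl v g \<otimes>\<^bsub>\<Gamma>\<^esub> n"
    using normal_form[of x] by (auto simp: free_part_def)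
  have "n \<in> free_part"
    using \<Gamma>.generate_subgroup_incl[OF basis_subset_free_part subgroup_free_part] *(3) by blast
  then have n: "n \<in> carrier \<Gamma>" "\<rho> n = \<one>\<^bsub>W.\<Gamma>\<^esub>" "\<sigma> n = \<one>\<^bsub>G v\<^esub>" by (simp_all add: free_part_def)
  have "\<rho> x = w" "\<sigma> x = g"
    using * n v by (simp_all add: \<rho>_\<iota> \<rho>_v \<sigma>_\<iota> \<sigma>_v)
  then have "w = \<one>\<^bsub>W.\<Gamma>\<^esub>" "g = \<one>\<^bsub>G v\<^esub>" using x by (simp_all add: free_part_def)
  then have "x = n" using *(4) n(1) v by (simp add: incl_one)
  then show "x \<in> generate \<Gamma> basis" using *(3) by simp
qed

abbreviation F :: "((('i \<times> 'a) list set set) \<times> bool) list set monoid" where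
  "F \<equiv> free_group_on basis"

sublocale F: group F
  by (rule group_free_group_on)

text \<open>The formal counterpart of a basis element: its letter in the free group, or the identity for the values of
  \<open>basis_elt\<close> that are trivial and therefore not in the basis.\<close>

definition basis_gen :: "('i \<times> 'a) list set set \<Rightarrow> 'a \<Rightarrow> ((('i \<times> 'a) list set set) \<times> bool) list set" where
  "basis_gen w g = (if basis_elt w g \<in> basis then free_generator basis (basis_elt w g) else \<one>\<^bsub>F\<^esub>)"

lemma basis_gen_closed [simp, intro]: "basis_gen w g \<in> carrier F"
  by (simp add: basis_gen_def free_generator_closed)

lemma basis_gen_one:
  "g \<in> carrier (G v) \<Longrightarrow> basis_gen \<one>\<^bsub>W.\<Gamma>\<^esub> g = \<one>\<^bsub>F\<^esub>"
  "w \<in> carrier W.\<Gamma> \<Longrightarrow> basis_gen w \<one>\<^bsub>G v\<^esub> = \<one>\<^bsub>F\<^esub>"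
  by (simp_all add: basis_gen_def basis_elt_one basis_def)

definition \<Omega> :: "('a \<times> ('i \<times> 'a) list set set \<times> ((('i \<times> 'a) list set set) \<times> bool) list set) set" where
  "\<Omega> = carrier (G v) \<times> carrier W.\<Gamma> \<times> carrier F"

text \<open>The point \<open>(g, w, c)\<close> stands for the normal form \<open>w g n\<close>, where \<open>n\<close> is the value of \<open>c\<close> in \<open>\<Gamma>\<close>, and
  the formula is left multiplication by \<open>h\<close> as computed in \<open>move_past_\<iota>\<close>, with letters in place of the
  basis elements.\<close>

definition vertex_act where
  "vertex_act i h = (\<lambda>(g, w, c).
     if i = v then (h \<otimes>\<^bsub>G v\<^esub> g, w, basis_gen w (h \<otimes>\<^bsub>G v\<^esub> g) \<otimes>\<^bsub>F\<^esub> (inv\<^bsub>F\<^esub> basis_gen w g \<otimes>\<^bsub>F\<^esub> c))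
     else (g, W.incl i h \<otimes>\<^bsub>W.\<Gamma>\<^esub> w, c))"

lemma vertex_act_closed:
  "i \<in> V \<Longrightarrow> h \<in> carrier (G i) \<Longrightarrow> s \<in> \<Omega> \<Longrightarrow> vertex_act i h s \<in> \<Omega>"
  by (auto simp: \<Omega>_def vertex_act_def)

text \<open>For the vertex \<open>v\<close> the correction factors telescope: the factor inverted by the second multiplication is the
  one inserted by the first.\<close>

lemma vertex_act_hom:
  assumes i: "i \<in> V"
  shows "(\<lambda>h. \<lambda>s\<in>\<Omega>. vertex_act i h s) \<in> hom (G i) (BijGroup \<Omega>)"
proof (rule BijGroup_homI)
  show "group (G i)" using i by (rule groups)
next
  show "vertex_act i h s \<in> \<Omega>" if "h \<in> carrier (G i)" "s \<in> \<Omega>" for h s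
    using i that by (rule vertex_act_closed)
next
  show "vertex_act i \<one>\<^bsub>G i\<^esub> s = s" if "s \<in> \<Omega>" for s
    using that i by (auto simp: \<Omega>_def vertex_act_def W.incl_one F.cancel_left)
next
  show "vertex_act i (g \<otimes>\<^bsub>G i\<^esub> h) s = vertex_act i g (vertex_act i h s)"
    if "g \<in> carrier (G i)" "h \<in> carrier (G i)" "s \<in> \<Omega>" for g h s
    using that i
    by (auto simp: \<Omega>_def vertex_act_def W.incl_mult Gv.m_assoc F.cancel_left W.\<Gamma>.m_assoc)
qed

lemma basis_gen_link:
  "{v, j} \<in> E \<Longrightarrow> l \<in> carrier (G j) \<Longrightarrow> w \<in> carrier W.\<Gamma> \<Longrightarrow> g \<in> carrier (G v) \<Longrightarrow>
    basis_gen (W.incl j l \<otimes>\<^bsub>W.\<Gamma>\<^esub> w) g = basis_gen w g"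
  by (simp add: basis_gen_def basis_elt_link)

text \<open>For an edge at \<open>v\<close>, the other endpoint changes \<open>w\<close> only by a left factor that the correction terms do not
  see.  Any other edge is an edge of the remaining graph.\<close>

lemma vertex_act_commute:
  assumes e: "{i, j} \<in> E" and gh: "g \<in> carrier (G i)" "h \<in> carrier (G j)" and s: "s \<in> \<Omega>"
  shows "vertex_act i g (vertex_act j h s) = vertex_act j h (vertex_act i g s)"
proof -
  note ij = edge_vertices[OF e]
  have e': "{j, i} \<in> E" using e by (simp add: insert_commute)
  obtain k w c where s': "s = (k, w, c)" "k \<in> carrier (G v)" "w \<in> carrier W.\<Gamma>" "c \<in> carrier F"
    using s by (auto simp: \<Omega>_def)
  consider "i = v" "j \<noteq> v" | "j = v" "i \<noteq> v" | "i \<noteq> v" "j \<noteq> v" using ij(3) by blast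
  then show ?thesis
  proof cases
    case 1
    then show ?thesis using e gh s' by (simp add: vertex_act_def basis_gen_link)
  next
    case 2
    then show ?thesis using e' gh s' by (simp add: vertex_act_def basis_gen_link)
  next
    case 3
    then have "{i, j} \<in> {e \<in> E. e \<subseteq> V - {v}}" "i \<in> V - {v}" "j \<in> V - {v}" using e ij by auto
    then show ?thesis
      using 3 gh s' W.incl_commute[of i j g h] by (simp add: vertex_act_def flip: W.\<Gamma>.m_assoc)
  qed
qed

text \<open>By the universal property the vertex actions combine into an action of \<open>\<Gamma>\<close>, to which the freeness
  criterion applies with the copy \<open>{1} \<times> {1} \<times> F\<close> of the free group.\<close>

lemma free_free_part: "free_group (\<Gamma>\<lparr>carrier := free_part\<rparr>)"
proof -
  let ?B = "BijGroup \<Omega>" and ?f = "\<lambda>i h. \<lambda>s\<in>\<Omega>. vertex_act i h s"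
  interpret B: group ?B by (rule group_BijGroup)
  have f: "?f i h \<in> Bij \<Omega>" if "i \<in> V" "h \<in> carrier (G i)" for i h
    using hom_in_carrier[OF vertex_act_hom that(2)] that(1) by (simp add: BijGroup_def)
  have comm: "?f i g \<otimes>\<^bsub>?B\<^esub> ?f j h = ?f j h \<otimes>\<^bsub>?B\<^esub> ?f i g"
    if e: "{i, j} \<in> E" and gh: "g \<in> carrier (G i)" "h \<in> carrier (G j)" for i j g h
    using f[OF edge_vertices(1)[OF e] gh(1)] f[OF edge_vertices(2)[OF e] gh(2)]
      vertex_act_closed[OF edge_vertices(1)[OF e] gh(1)] vertex_act_closed[OF edge_vertices(2)[OF e] gh(2)]
    by (auto simp: BijGroup_def compose_def vertex_act_commute[OF e gh] intro!: restrict_ext)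
  obtain \<Theta> where \<Theta>: "\<Theta> \<in> hom \<Gamma> ?B" "\<And>i h. i \<in> V \<Longrightarrow> h \<in> carrier (G i) \<Longrightarrow> \<Theta> (incl i h) = ?f i h"
    by (rule graph_product_lift[OF B.group_axioms vertex_act_hom comm]) (use that in blast)+
  interpret \<Theta>: group_hom \<Gamma> ?B \<Theta> by unfold_locales (rule \<Theta>(1))
  have \<Theta>_Bij: "\<Theta> x \<in> Bij \<Omega>" if "x \<in> carrier \<Gamma>" for x
    using \<Theta>.hom_closed[OF that] by (simp add: BijGroup_def)
  have \<Theta>_one: "\<Theta> \<one>\<^bsub>\<Gamma>\<^esub> s = s" if "s \<in> \<Omega>" for s
    using that by (simp add: BijGroup_def)
  have \<Theta>_mult: "\<Theta> (x \<otimes>\<^bsub>\<Gamma>\<^esub> z) s = \<Theta> x (\<Theta> z s)" if "x \<in> carrier \<Gamma>" "z \<in> carrier \<Gamma>" "s \<in> \<Omega>" for x z s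
    using that by (simp add: \<Theta>.hom_mult, simp add: BijGroup_def \<Theta>_Bij compose_eq)
  \<comment> \<open>The action is computed on points, so products must not be rewritten into
    compositions in the group of bijections.\<close>
  note [simp del] = \<Theta>.hom_one \<Theta>.hom_mult \<Theta>.hom_inv
  have \<Theta>_inv: "\<Theta> (inv\<^bsub>\<Gamma>\<^esub> x) t = s" if "x \<in> carrier \<Gamma>" "s \<in> \<Omega>" "\<Theta> x s = t" for x s t
    using \<Theta>_mult[of "inv\<^bsub>\<Gamma>\<^esub> x" x s] \<Theta>_one[of s] that by simp
  have \<Omega>I: "(g, w, c) \<in> \<Omega>" if "g \<in> carrier (G v)" "w \<in> carrier W.\<Gamma>" "c \<in> carrier F" for g w c
    using that by (simp add: \<Omega>_def)
  have \<Theta>_v: "\<Theta> (incl v h) (g, w, c) = (h \<otimes>\<^bsub>G v\<^esub> g, w, basis_gen w (h \<otimes>\<^bsub>G v\<^esub> g) \<otimes>\<^bsub>F\<^esub> (inv\<^bsub>F\<^esub> basis_gen w g \<otimes>\<^bsub>F\<^esub> c))"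
    if "h \<in> carrier (G v)" "g \<in> carrier (G v)" "w \<in> carrier W.\<Gamma>" "c \<in> carrier F" for h g w c
    using that v by (simp add: \<Theta>(2) \<Omega>I vertex_act_def)
  have \<Theta>_\<iota>: "\<Theta> (\<iota> w) (g, w', c) = (g, w \<otimes>\<^bsub>W.\<Gamma>\<^esub> w', c)"
    if "w \<in> carrier W.\<Gamma>" "g \<in> carrier (G v)" "w' \<in> carrier W.\<Gamma>" "c \<in> carrier F" for w g w' c
    using that(1)
  proof (induction rule: W.graph_product_induct)
    case one
    then show ?case using that by (simp add: \<Theta>_one \<Omega>I)
  next
    case (step i h z)
    then show ?case
      using that by (simp add: \<iota>_incl \<Theta>_mult \<Omega>I \<Theta>(2) vertex_act_def W.\<Gamma>.m_assoc)
  qed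
  \<comment> \<open>The four factors lead through the points \<open>(1, w)\<close>, \<open>(g, w)\<close>, \<open>(g, 1)\<close> and \<open>(1, 1)\<close>.
    Only the second one changes the last component by a letter, because the letters for \<open>w = 1\<close> and for
    \<open>g = 1\<close> are trivial.\<close>
  have \<Theta>_basis_elt: "\<Theta> (basis_elt w g) (\<one>\<^bsub>G v\<^esub>, \<one>\<^bsub>W.\<Gamma>\<^esub>, c) = (\<one>\<^bsub>G v\<^esub>, \<one>\<^bsub>W.\<Gamma>\<^esub>, basis_gen w g \<otimes>\<^bsub>F\<^esub> c)"
    if w: "w \<in> carrier W.\<Gamma>" and g: "g \<in> carrier (G v)" and c: "c \<in> carrier F" for w g c
  proof -
    let ?c = "basis_gen w g \<otimes>\<^bsub>F\<^esub> c"
    have c': "?c \<in> carrier F" using c by simp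
    have 1: "\<Theta> (inv\<^bsub>\<Gamma>\<^esub> \<iota> w) (g, w, ?c) = (g, \<one>\<^bsub>W.\<Gamma>\<^esub>, ?c)"
      by (rule \<Theta>_inv) (use w g c' in \<open>simp_all add: \<Omega>I \<Theta>_\<iota>\<close>)
    have 2: "\<Theta> (inv\<^bsub>\<Gamma>\<^esub> incl v g) (g, \<one>\<^bsub>W.\<Gamma>\<^esub>, ?c) = (\<one>\<^bsub>G v\<^esub>, \<one>\<^bsub>W.\<Gamma>\<^esub>, ?c)"
      by (rule \<Theta>_inv) (use w g c' v in \<open>simp_all add: \<Omega>I \<Theta>_v basis_gen_one\<close>)
    show ?thesis
      using w g c c' v by (simp add: basis_elt_def \<Theta>_mult \<Omega>I \<Theta>_\<iota> \<Theta>_v basis_gen_one 1 2)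
  qed
  let ?K = "\<Gamma>\<lparr>carrier := free_part\<rparr>" and ?j = "\<lambda>c. (\<one>\<^bsub>G v\<^esub>, \<one>\<^bsub>W.\<Gamma>\<^esub>, c)"
  have NG: "x \<in> carrier \<Gamma>" if "x \<in> free_part" for x using that by (simp add: free_part_def)
  show ?thesis
  proof (rule free_groupI[where X = basis and S = \<Omega> and act = \<Theta> and j = ?j])
    show "group ?K" by (rule \<Gamma>.subgroup_imp_group[OF subgroup_free_part])
    show "basis \<subseteq> carrier ?K" using basis_subset_free_part by simp
    show "carrier ?K \<subseteq> generate ?K basis"
      using free_part_generated \<Gamma>.generate_consistent[OF basis_subset_free_part subgroup_free_part] by simp
    show "\<Theta> \<one>\<^bsub>?K\<^esub> s = s" if "s \<in> \<Omega>" for s using that by (simp add: \<Theta>_one)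
    show "\<Theta> (x \<otimes>\<^bsub>?K\<^esub> z) s = \<Theta> x (\<Theta> z s)" if "x \<in> carrier ?K" "z \<in> carrier ?K" "s \<in> \<Omega>" for x z s
      using that NG by (simp add: \<Theta>_mult)
    show "inj_on ?j (carrier F)" by (simp add: inj_on_def)
    show "?j ` carrier F \<subseteq> \<Omega>" by (auto simp: \<Omega>_def)
    show "\<Theta> x (?j c) = ?j (free_generator basis x \<otimes>\<^bsub>F\<^esub> c)" if x: "x \<in> basis" and c: "c \<in> carrier F" for x c
    proof -
      obtain w g where "x = basis_elt w g" "w \<in> carrier W.\<Gamma>" "g \<in> carrier (G v)"
        using x by (auto simp: basis_def)
      then show ?thesis using x \<Theta>_basis_elt[of w g c] c by (simp add: basis_gen_def)
    qed
  qed
qed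

end

context graph_of_groups
begin

lemma proj_hom: "graph_product_proj V G \<in> hom \<Gamma> (product_group V G)"
  using graph_product_proj_epi(1)[where G = G, OF graph groups] by (simp add: epi_def)

lemma proj_incl:
  "i \<in> V \<Longrightarrow> g \<in> carrier (G i) \<Longrightarrow> graph_product_proj V G (incl i g) = product_incl V G i g"
  by (rule graph_product_proj_epi(2)[where G = G, OF graph groups])

sublocale proj: group_hom \<Gamma> "product_group V G" "graph_product_proj V G"
  by (simp add: group_hom_def group_hom_axioms_def proj_hom groups)

lemma proj_component_closed:
  "x \<in> carrier \<Gamma> \<Longrightarrow> i \<in> V \<Longrightarrow> graph_product_proj V G x i \<in> carrier (G i)"
  using proj.hom_closed[of x] by (auto simp: PiE_iff)

lemma in_proj_kernel_iff:
  "x \<in> kernel \<Gamma> (product_group V G) (graph_product_proj V G) \<longleftrightarrow>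
    x \<in> carrier \<Gamma> \<and> (\<forall>i\<in>V. graph_product_proj V G x i = \<one>\<^bsub>G i\<^esub>)"
  using proj.hom_closed[of x] by (auto simp: kernel_def fun_eq_iff PiE_iff extensional_def)

text \<open>Choosing the coordinate at \<open>v\<close> of the projection to the direct product for \<open>\<sigma>\<close> makes the comparison of the
  kernels of the two projections in \<open>in_K_iff\<close> immediate.\<close>

lemma vertex_splitting_exists:
  assumes v: "v \<in> V"
  shows "\<exists>\<rho> \<iota>. vertex_splitting V E G v \<rho> \<iota> (\<lambda>x. graph_product_proj V G x v)"
proof -
  let ?W = "V - {v}" and ?E = "{e \<in> E. e \<subseteq> V - {v}}"
  interpret W: graph_of_groups ?W ?E G by (rule graph_of_groups_subset) simp
  interpret Gv: group "G v" using v by (rule groups)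
  let ?r = "\<lambda>i g. if i = v then \<one>\<^bsub>W.\<Gamma>\<^esub> else W.incl i g"
  obtain \<rho> where \<rho>: "\<rho> \<in> hom \<Gamma> W.\<Gamma>" "\<And>i g. i \<in> V \<Longrightarrow> g \<in> carrier (G i) \<Longrightarrow> \<rho> (incl i g) = ?r i g"
  proof (rule graph_product_lift[OF W.\<Gamma>.group_axioms, of ?r])
    show "?r i \<in> hom (G i) W.\<Gamma>" if "i \<in> V" for i
      using that W.incl_hom[of i] by (auto simp: hom_def)
    show "?r i g \<otimes>\<^bsub>W.\<Gamma>\<^esub> ?r j h = ?r j h \<otimes>\<^bsub>W.\<Gamma>\<^esub> ?r i g"
      if e: "{i, j} \<in> E" and gh: "g \<in> carrier (G i)" "h \<in> carrier (G j)" for i j g h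
    proof (cases "i = v \<or> j = v")
      case True
      then show ?thesis using edge_vertices[OF e] gh by auto
    next
      case False
      then show ?thesis using edge_vertices[OF e] e gh W.incl_commute[of i j g h] by simp
    qed
  qed blast
  obtain \<iota> where \<iota>: "\<iota> \<in> hom W.\<Gamma> \<Gamma>"
    "\<And>i g. i \<in> ?W \<Longrightarrow> g \<in> carrier (G i) \<Longrightarrow> \<iota> (W.incl i g) = incl i g"
  proof (rule W.graph_product_lift[OF \<Gamma>.group_axioms, of incl])
    show "incl i \<in> hom (G i) \<Gamma>" if "i \<in> ?W" for i using that by (simp add: incl_hom)
    show "incl i g \<otimes>\<^bsub>\<Gamma>\<^esub> incl j h = incl j h \<otimes>\<^bsub>\<Gamma>\<^esub> incl i g"
      if "{i, j} \<in> ?E" "g \<in> carrier (G i)" "h \<in> carrier (G j)" for i j g h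
      using that by (intro incl_commute) simp_all
  qed blast
  have \<sigma>: "(\<lambda>x. graph_product_proj V G x v) \<in> hom \<Gamma> (G v)"
    using v by (intro homI) (simp_all add: proj_component_closed)
  have "vertex_splitting V E G v \<rho> \<iota> (\<lambda>x. graph_product_proj V G x v)"
    by unfold_locales (use v \<rho> \<iota> \<sigma> in \<open>auto simp: proj_incl product_incl_def\<close>)
  then show ?thesis by blast
qed

end

context vertex_splitting
begin

abbreviation K :: "('i \<times> 'a) list set set set" where
  "K \<equiv> kernel \<Gamma> (product_group V G) (graph_product_proj V G)"

abbreviation K\<^sub>W :: "('i \<times> 'a) list set set set" where
  "K\<^sub>W \<equiv> kernel W.\<Gamma> (product_group (V - {v}) G) (graph_product_proj (V - {v}) G)"

lemma proj_eq:
  assumes "x \<in> carrier \<Gamma>" "i \<in> V"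
  shows "graph_product_proj V G x i = (if i = v then \<sigma> x else graph_product_proj (V - {v}) G (\<rho> x) i)"
  using assms(1)
proof (induction rule: graph_product_induct)
  case one
  then show ?case using assms(2) by simp
next
  case (step j g x)
  then show ?case
    using assms(2)
    by (cases "j = v") (auto simp: proj_incl W.proj_incl product_incl_def \<rho>_v \<rho>_incl \<sigma>_v \<sigma>_incl group.is_monoid groups
        W.proj_component_closed)
qed

lemma in_K_iff: "x \<in> K \<longleftrightarrow> x \<in> carrier \<Gamma> \<and> \<rho> x \<in> K\<^sub>W \<and> \<sigma> x = \<one>\<^bsub>G v\<^esub>"
proof (cases "x \<in> carrier \<Gamma>")
  case True
  have "(\<forall>i\<in>V. graph_product_proj V G x i = \<one>\<^bsub>G i\<^esub>) \<longleftrightarrow>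
      \<sigma> x = \<one>\<^bsub>G v\<^esub> \<and> (\<forall>i\<in>V - {v}. graph_product_proj (V - {v}) G (\<rho> x) i = \<one>\<^bsub>G i\<^esub>)"
    using v proj_eq[OF True] by auto
  then show ?thesis
    using True by (auto simp: in_proj_kernel_iff W.in_proj_kernel_iff)
qed (simp add: in_proj_kernel_iff)

lemma poly_free_free_part: "poly_free (\<Gamma>\<lparr>carrier := free_part\<rparr>)"
  by (rule free_imp_poly_free[OF \<Gamma>.subgroup_imp_group[OF subgroup_free_part] free_free_part])

text \<open>The section \<open>\<iota>\<close> maps the kernel for the remaining vertices into the kernel for \<open>V\<close>, so \<open>\<rho>\<close>
  restricts to an epimorphism between the two kernels.\<close>

lemma poly_free_K:
  assumes "poly_free (W.\<Gamma>\<lparr>carrier := K\<^sub>W\<rparr>)"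
  shows "poly_free (\<Gamma>\<lparr>carrier := K\<rparr>)"
proof (rule poly_free_extension[where \<pi> = \<rho> and Q = "W.\<Gamma>\<lparr>carrier := K\<^sub>W\<rparr>"])
  show "group (\<Gamma>\<lparr>carrier := K\<rparr>)"
    by (rule \<Gamma>.subgroup_imp_group[OF proj.subgroup_kernel])
  have K: "x \<in> carrier \<Gamma>" "\<rho> x \<in> K\<^sub>W" "\<sigma> x = \<one>\<^bsub>G v\<^esub>" if "x \<in> K" for x
    using that unfolding in_K_iff by blast+
  show "\<rho> \<in> hom (\<Gamma>\<lparr>carrier := K\<rparr>) (W.\<Gamma>\<lparr>carrier := K\<^sub>W\<rparr>)"
    by (rule homI) (simp_all add: K)
  show "\<rho> ` carrier (\<Gamma>\<lparr>carrier := K\<rparr>) = carrier (W.\<Gamma>\<lparr>carrier := K\<^sub>W\<rparr>)"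
  proof
    show "carrier (W.\<Gamma>\<lparr>carrier := K\<^sub>W\<rparr>) \<subseteq> \<rho> ` carrier (\<Gamma>\<lparr>carrier := K\<rparr>)"
    proof
      fix w assume "w \<in> carrier (W.\<Gamma>\<lparr>carrier := K\<^sub>W\<rparr>)"
      then have w: "w \<in> K\<^sub>W" "w \<in> carrier W.\<Gamma>" by (simp_all add: kernel_def)
      then have "\<iota> w \<in> K" by (simp add: in_K_iff \<rho>_\<iota> \<sigma>_\<iota>)
      then show "w \<in> \<rho> ` carrier (\<Gamma>\<lparr>carrier := K\<rparr>)" 
        using \<rho>_\<iota>[OF w(2)] by (intro image_eqI[of _ _ "\<iota> w"]) simp_all
    qed
  qed (use K in auto)
  have "\<one>\<^bsub>W.\<Gamma>\<^esub> \<in> K\<^sub>W" by (rule subgroup.one_closed[OF W.proj.subgroup_kernel])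
  then have "kernel (\<Gamma>\<lparr>carrier := K\<rparr>) (W.\<Gamma>\<lparr>carrier := K\<^sub>W\<rparr>) \<rho> = free_part"
    by (auto simp: kernel_def[of "\<Gamma>\<lparr>carrier := K\<rparr>"] free_part_def in_K_iff)
  then show "poly_free (\<Gamma>\<lparr>carrier := K\<rparr>\<lparr>carrier := kernel (\<Gamma>\<lparr>carrier := K\<rparr>) (W.\<Gamma>\<lparr>carrier := K\<^sub>W\<rparr>) \<rho>\<rparr>)"
    using poly_free_free_part by simp
qed (rule assms)

lemma poly_free_\<Gamma>:
  assumes "poly_free W.\<Gamma>" "poly_free (G v)"
  shows "poly_free \<Gamma>"
proof (rule poly_free_extension[where \<pi> = \<rho>, OF \<Gamma>.group_axioms \<rho>_hom _ assms(1)])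
  show "\<rho> ` carrier \<Gamma> = carrier W.\<Gamma>"
  proof
    show "carrier W.\<Gamma> \<subseteq> \<rho> ` carrier \<Gamma>"
    proof
      fix w assume "w \<in> carrier W.\<Gamma>"
      then show "w \<in> \<rho> ` carrier \<Gamma>"
        using \<rho>_\<iota>[of w] by (intro image_eqI[of _ _ "\<iota> w"]) simp_all
    qed
  qed (use \<rho>.hom_closed in blast)
  let ?M = "\<Gamma>\<lparr>carrier := kernel \<Gamma> W.\<Gamma> \<rho>\<rparr>"
  show "poly_free ?M"
  proof (rule poly_free_extension[where G = ?M and \<pi> = \<sigma>, OF _ _ _ assms(2)])
    show "group ?M" by (rule \<Gamma>.subgroup_imp_group[OF \<rho>.subgroup_kernel])
    show "\<sigma> \<in> hom ?M (G v)" by (rule homI) (simp_all add: kernel_def)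
    have "incl v g \<in> kernel \<Gamma> W.\<Gamma> \<rho>" if "g \<in> carrier (G v)" for g
      using that v by (simp add: kernel_def \<rho>_v)
    then have "g \<in> \<sigma> ` carrier ?M" if "g \<in> carrier (G v)" for g
      using that \<sigma>_v[OF that] by (intro image_eqI[of _ _ "incl v g"]) simp_all
    then show "\<sigma> ` carrier ?M = carrier (G v)" by (auto simp: kernel_def)
    have "kernel ?M (G v) \<sigma> = free_part" by (auto simp: kernel_def free_part_def)
    then show "poly_free (?M\<lparr>carrier := kernel ?M (G v) \<sigma>\<rparr>)" using poly_free_free_part by simp
  qed
qed

end

section \<open>Induction on the number of vertices\<close>

lemma poly_free_graph_product:
  assumes "finite V" "graph_of_groups V E G"
  shows "poly_free ((graph_product V E G)\<lparr>carrier :=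
           kernel (graph_product V E G) (product_group V G) (graph_product_proj V G)\<rparr>) \<and>
         ((\<forall>i\<in>V. poly_free (G i)) \<longrightarrow> poly_free (graph_product V E G))"
  using assms
proof (induction V arbitrary: E rule: finite_psubset_induct)
  case (psubset V)
  interpret graph_of_groups V E G by (rule psubset.prems)
  show ?case
  proof (cases "V = {}")
    case True
    have "x = \<one>\<^bsub>\<Gamma>\<^esub>" if "x \<in> carrier \<Gamma>" for x
      using that by (induction rule: graph_product_induct) (simp_all add: True)
    then have triv: "carrier \<Gamma> = {\<one>\<^bsub>\<Gamma>\<^esub>}" by auto
    have "kernel \<Gamma> (product_group V G) (graph_product_proj V G) = {\<one>\<^bsub>\<Gamma>\<^esub>}"
      using subgroup.subset[OF proj.subgroup_kernel] subgroup.one_closed[OF proj.subgroup_kernel] triv by blast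
    moreover have "poly_free (\<Gamma>\<lparr>carrier := {\<one>\<^bsub>\<Gamma>\<^esub>}\<rparr>)"
      by (rule trivial_imp_poly_free[OF \<Gamma>.subgroup_imp_group[OF \<Gamma>.triv_subgroup]]) simp
    ultimately show ?thesis using trivial_imp_poly_free[OF \<Gamma>.group_axioms triv] by simp
  next
    case False
    then obtain v where v: "v \<in> V" by blast
    then obtain \<rho> \<iota> where "vertex_splitting V E G v \<rho> \<iota> (\<lambda>x. graph_product_proj V G x v)"
      using vertex_splitting_exists by blast
    then interpret vertex_splitting V E G v \<rho> \<iota> "\<lambda>x. graph_product_proj V G x v" .
    have "V - {v} \<subset> V" using v by blast
    from psubset.IH[OF this W.graph_of_groups_axioms] show ?thesis
      using poly_free_K poly_free_\<Gamma> v by blast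
  qed
qed

theorem corollary1p5:
  fixes V :: "'i set" and E :: "'i set set" and G :: "'i \<Rightarrow> 'a monoid"
  assumes "finite_simplicial_graph V E"
    and "\<And>i. i \<in> V \<Longrightarrow> group (G i)"
    and "\<And>i. i \<in> V \<Longrightarrow> countable (carrier (G i))"
  shows "poly_free ((graph_product V E G)\<lparr>carrier :=
           kernel (graph_product V E G) (product_group V G) (graph_product_proj V G)\<rparr>) \<and>
         ((\<forall>i\<in>V. poly_free (G i)) \<longrightarrow> poly_free (graph_product V E G))"
proof (rule poly_free_graph_product)
  show "finite V" using assms(1) by (simp add: finite_simplicial_graph_def)
  show "graph_of_groups V E G" using assms(1,2) by (rule graph_of_groups.intro)
qed

end
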